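(* Let $p$ be an odd prime and $m\in\mathbb{Z}$ with $p\nmid m$. Let $s'(p)$ be the number of pairs $(i,j)$ with $1\le i<j\le (p-1)/2$ and $\widetilde{mi^2}>\widetilde{mj^2}$. Then $s'(p)\equiv \left\lfloor \frac{p+1}{8}\right\rfloor \pmod 2$.
   Context: For an integer $x$, $\{x\}_p$ denotes the least nonnegative residue of $x$ modulo $p$, and $\widetilde{x}=p-\{x\}_p$ if $\{x\}_p>p/2$, while $\widetilde{x}=\{x\}_p$ if $\{x\}_p<p/2$. $\lfloor\cdot\rfloor$ is the floor function. *)

theory Defs
  imports Complex_Main "HOL-Number_Theory.Number_Theory"
begin

(* The two cases are those of the paper; for odd p the value {x}_p = p/2 cannot occur. *)
definition tilde :: "nat \<Rightarrow> int \<Rightarrow> int" where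
  "tilde p x = (if real_of_int (x mod int p) > real p / 2 then int p - x mod int p else x mod int p)"

definition s' :: "nat \<Rightarrow> int \<Rightarrow> nat" where
  "s' p m = card {(i, j). 1 \<le> i \<and> i < j \<and> j \<le> (p - 1) div 2 \<and>
                          tilde p (m * (int i)\<^sup>2) > tilde p (m * (int j)\<^sup>2)}"

end

theory Submission
  imports Defs
begin

text \<open>
  Write \<open>n = (p - 1) / 2\<close> and \<open>f i = tilde (m i\<^sup>2)\<close>.  The sign \<open>(-1)\<^bsup>s'\<^esup>\<close> is the product over \<open>i < j \<le> n\<close>
  of the signs of \<open>(i - j) (f i - f j)\<close>, equivalently of \<open>(i\<^sup>2 - j\<^sup>2) ((f i)\<^sup>2 - (f j)\<^sup>2)\<close>, and
  \<open>(f i)\<^sup>2\<close> is \<open>m\<^sup>2 i\<^sup>4\<close> modulo \<open>p\<close>.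

  If \<open>n\<close> is odd, \<open>f\<close> permutes \<open>{1..n}\<close>, so the sign is congruent to the product of the
  \<open>m\<^sup>2 (i\<^sup>2 + j\<^sup>2)\<close>.  As \<open>-1\<close> is not a square, it equals the product of the Legendre symbols of
  \<open>i\<^sup>2 + j\<^sup>2\<close>, and by homogeneity it suffices to count the nonresidues \<open>1 + t\<^sup>2\<close>.

  If \<open>n = 2 k\<close>, let \<open>v\<^sup>2 = -1\<close>.  The fibres of \<open>f\<close> are the pairs \<open>{a, \<sigma> a}\<close> with \<open>\<sigma> a = \<plusminus>v a\<close>.  Two
  fibres contribute four pairs of indices on which \<open>f i - f j\<close> has the same absolute value, so the
  sign does not depend on \<open>f\<close>; it is the sign of the product of the \<open>i\<^sup>2 - j\<^sup>2\<close> over pairs of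
  indices in different fibres.  Modulo \<open>p\<close> this product is the discriminant of the set of fourth
  powers, whereas its absolute value is the Vandermonde product of the squares divided by the
  product \<open>E\<close> of the \<open>(\<sigma> a)\<^sup>2 - a\<^sup>2\<close>, where \<open>a < \<sigma> a\<close>.  Wilson's theorem evaluates the first two, and
  \<open>E\<close> is \<open>(-1)\<^sup>k n!\<close>.
\<close>

section \<open>Products over pairs\<close>

text \<open>Restricting to \<open>i < j\<close> counts every unordered pair once. For symmetric
  \<open>g\<close> the product does not depend on the order, which is why symmetry is assumed
  whenever indices move.\<close>

definition pairprod :: "('a::linorder \<Rightarrow> 'a \<Rightarrow> 'b::comm_monoid_mult) \<Rightarrow> 'a set \<Rightarrow> 'b" where
  "pairprod g S = (\<Prod>(i, j)\<in>{(i, j). i \<in> S \<and> j \<in> S \<and> i < j}. g i j)"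

lemma finite_pairs:
  fixes S :: "'a::linorder set"
  assumes "finite S"
  shows "finite {(i, j). i \<in> S \<and> j \<in> S \<and> i < j}"
  by (rule finite_subset[of _ "S \<times> S"]) (use assms in auto)

lemma pairprod_empty [simp]: "pairprod g {} = 1"
  by (simp add: pairprod_def)

lemma pairprod_insert:
  assumes fin: "finite S" and x: "x \<notin> S" and sym: "\<And>i j. g i j = g j i"
  shows "pairprod g (insert x S) = pairprod g S * (\<Prod>i\<in>S. g i x)"
proof -
  let ?P = "\<lambda>S. {(i, j). i \<in> S \<and> j \<in> S \<and> i < j}"
  \<comment> \<open>The new element may fall on either side of \<open>i\<close>, so the pair is put
    in increasing order.\<close>
  let ?e = "\<lambda>i. if i < x then (i, x) else (x, i)"
  have eq: "?P (insert x S) = ?P S \<union> ?e ` S"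
    using x by (auto simp: image_iff) (metis linorder_neqE order_less_imp_not_less)+
  have inj: "inj_on ?e S"
    by (auto simp: inj_on_def)
  have "pairprod g (insert x S) = pairprod g S * prod (\<lambda>(i, j). g i j) (?e ` S)"
    unfolding pairprod_def eq
    by (rule prod.union_disjoint) (use fin x in \<open>auto simp: finite_pairs split: if_splits\<close>)
  also have "prod (\<lambda>(i, j). g i j) (?e ` S) = (\<Prod>i\<in>S. g i x)"
    unfolding prod.reindex[OF inj] by (rule prod.cong) (use sym in auto)
  finally show ?thesis .
qed

lemma pairprod_cong:
  assumes "\<And>i j. i \<in> S \<Longrightarrow> j \<in> S \<Longrightarrow> i < j \<Longrightarrow> g i j = h i j"
  shows "pairprod g S = pairprod h S"
  unfolding pairprod_def by (rule prod.cong) (use assms in auto)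

lemma pairprod_cong_mod:
  fixes g h :: "'a::linorder \<Rightarrow> 'a \<Rightarrow> int"
  assumes "\<And>i j. i \<in> S \<Longrightarrow> j \<in> S \<Longrightarrow> i < j \<Longrightarrow> [g i j = h i j] (mod q)"
  shows "[pairprod g S = pairprod h S] (mod q)"
  unfolding pairprod_def by (rule cong_prod) (use assms in auto)

lemma pairprod_mult: "pairprod (\<lambda>i j. g i j * h i j) S = pairprod g S * pairprod h S"
  unfolding pairprod_def by (simp add: prod.distrib[symmetric] case_prod_unfold)

lemma pairprod_power:
  fixes g :: "'a::linorder \<Rightarrow> 'a \<Rightarrow> 'b::comm_semiring_1"
  shows "pairprod (\<lambda>i j. g i j ^ r) S = pairprod g S ^ r"
  unfolding pairprod_def by (simp add: prod_power_distrib case_prod_unfold)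

lemma pairprod_const:
  fixes S :: "'a::linorder set" and c :: "'b::comm_monoid_mult"
  assumes "finite S"
  shows "pairprod (\<lambda>_ _. c) S = c ^ (card S choose 2)"
  using assms
proof (induction S rule: finite_induct)
  case empty
  then show ?case by (simp add: numeral_2_eq_2)
next
  case (insert x S)
  then show ?case
    by (subst pairprod_insert) (auto simp: power_add numeral_2_eq_2 add.commute mult.commute)
qed

lemma pairprod_reindex:
  assumes fin: "finite S" and inj: "inj_on f S" and sym: "\<And>i j. g i j = g j i"
  shows "pairprod g (f ` S) = pairprod (\<lambda>i j. g (f i) (f j)) S"
  using fin inj
proof (induction S rule: finite_induct)
  case (insert x S)
  have "pairprod g (insert (f x) (f ` S)) = pairprod g (f ` S) * (\<Prod>i\<in>f ` S. g i (f x))"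
    by (rule pairprod_insert) (use insert sym in auto)
  also have "(\<Prod>i\<in>f ` S. g i (f x)) = (\<Prod>i\<in>S. g (f i) (f x))"
    using insert.prems by (subst prod.reindex) auto
  also have "pairprod g (f ` S) * \<dots> = pairprod (\<lambda>i j. g (f i) (f j)) (insert x S)"
    using insert by (subst pairprod_insert) (auto intro: sym)
  finally show ?case by simp
qed simp

text \<open>Converts a count of pairs into a sign; it serves both for inversions and for pairs with
  a nonresidue \<open>i^2 + j^2\<close>.\<close>

lemma pairprod_sign:
  fixes S :: "'a::linorder set"
  assumes "finite S"
  shows "pairprod (\<lambda>i j. if Q i j then - 1 else 1 :: int) S
           = (- 1) ^ card {(i, j). i \<in> S \<and> j \<in> S \<and> i < j \<and> Q i j}"
proof -
  let ?P = "{(i, j). i \<in> S \<and> j \<in> S \<and> i < j}"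
  have "pairprod (\<lambda>i j. if Q i j then - 1 else 1 :: int) S
      = (\<Prod>x\<in>?P. if case_prod Q x then - 1 else 1)"
    unfolding pairprod_def by (rule prod.cong) auto
  also have "\<dots> = (\<Prod>x\<in>{x\<in>?P. case_prod Q x}. - 1)"
    using finite_pairs[OF assms] by (rule prod.inter_filter[symmetric])
  also have "\<dots> = (- 1) ^ card {x\<in>?P. case_prod Q x}"
    by simp
  also have "{x\<in>?P. case_prod Q x} = {(i, j). i \<in> S \<and> j \<in> S \<and> i < j \<and> Q i j}"
    by auto
  finally show ?thesis .
qed

text \<open>Groups ordered pairs into unordered ones. With \<open>g i j\<close> a difference of
  values, the left side is a product of derivatives and the right side a discriminant up to
  sign.\<close>

lemma prod_off_diagonal:
  fixes S :: "'a::linorder set" and g :: "'a \<Rightarrow> 'a \<Rightarrow> 'b::comm_monoid_mult"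
  assumes "finite S"
  shows "(\<Prod>i\<in>S. \<Prod>j\<in>S - {i}. g i j) = pairprod (\<lambda>i j. g i j * g j i) S"
  using assms
proof (induction S rule: finite_induct)
  case (insert x S)
  have "(\<Prod>i\<in>S. \<Prod>j\<in>insert x S - {i}. g i j) = (\<Prod>i\<in>S. g i x * (\<Prod>j\<in>S - {i}. g i j))"
  proof (rule prod.cong)
    fix i assume "i \<in> S"
    then have "insert x S - {i} = insert x (S - {i})"
      using insert.hyps by auto
    then show "(\<Prod>j\<in>insert x S - {i}. g i j) = g i x * (\<Prod>j\<in>S - {i}. g i j)"
      using insert.hyps by simp
  qed simp
  moreover have "insert x S - {x} = S"
    using insert.hyps by auto
  ultimately have "(\<Prod>i\<in>insert x S. \<Prod>j\<in>insert x S - {i}. g i j)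
      = pairprod (\<lambda>i j. g i j * g j i) S * (\<Prod>i\<in>S. g i x * g x i)"
    using insert by (simp add: prod.distrib ac_simps)
  then show ?case
    using insert.hyps by (subst pairprod_insert) (auto simp: mult.commute)
qed simp

lemma prod_Un_involution:
  assumes "finite A" "inj_on \<sigma> A" "A \<inter> \<sigma> ` A = {}"
  shows "(\<Prod>i\<in>A \<union> \<sigma> ` A. g i) = (\<Prod>a\<in>A. g a * g (\<sigma> a))"
  using assms by (simp add: prod.union_disjoint prod.reindex prod.distrib)

text \<open>Two indices lie either in one fibre \<open>{a, \<sigma> a}\<close> or in two different
  fibres; in the second case the representatives \<open>a < b\<close> account for four
  pairs.\<close>

lemma pairprod_Un_involution:
  fixes A :: "'a::linorder set"
  assumes "finite A" "inj_on \<sigma> A" "A \<inter> \<sigma> ` A = {}" and sym: "\<And>i j. g i j = g j i"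
  shows "pairprod g (A \<union> \<sigma> ` A)
           = pairprod (\<lambda>a b. g a b * g a (\<sigma> b) * g (\<sigma> a) b * g (\<sigma> a) (\<sigma> b)) A
             * (\<Prod>a\<in>A. g a (\<sigma> a))"
  using assms(1-3)
proof (induction A rule: finite_induct)
  case (insert b A)
  let ?I = "A \<union> \<sigma> ` A"
  let ?g4 = "\<lambda>a b. g a b * g a (\<sigma> b) * g (\<sigma> a) b * g (\<sigma> a) (\<sigma> b)"
  have eq: "insert b A \<union> \<sigma> ` insert b A = insert (\<sigma> b) (insert b ?I)"
    by auto
  have b: "b \<notin> ?I" and sb: "\<sigma> b \<notin> insert b ?I"
    using insert.hyps insert.prems by (auto simp: inj_on_def)
  have prod: "(\<Prod>i\<in>?I. h i) = (\<Prod>a\<in>A. h a * h (\<sigma> a))" for h :: "'a \<Rightarrow> 'b"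
    by (rule prod_Un_involution) (use insert.hyps insert.prems in \<open>auto simp: inj_on_def\<close>)
  have IH: "pairprod g ?I = pairprod ?g4 A * (\<Prod>a\<in>A. g a (\<sigma> a))"
    by (rule insert.IH) (use insert.prems in auto)
  have "pairprod g (insert (\<sigma> b) (insert b ?I))
      = pairprod g ?I * (\<Prod>i\<in>?I. g i b) * (g b (\<sigma> b) * (\<Prod>i\<in>?I. g i (\<sigma> b)))"
    using insert.hyps b sb sym by (simp add: pairprod_insert)
  also have "\<dots> = pairprod ?g4 A * (\<Prod>a\<in>A. ?g4 a b) * (\<Prod>a\<in>insert b A. g a (\<sigma> a))"
    using insert.hyps by (simp add: IH prod prod.distrib ac_simps)
  also have "pairprod ?g4 A * (\<Prod>a\<in>A. ?g4 a b) = pairprod ?g4 (insert b A)"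
    by (rule pairprod_insert[symmetric]) (use insert.hyps sym in \<open>auto simp: ac_simps\<close>)
  finally show ?case
    by (simp only: eq)
qed simp

section \<open>Products of differences of squares\<close>

lemma int_interval_Suc: "{1..int (Suc n)} = insert (int n + 1) {1..int n}"
  by auto

lemma prod_int_interval_fact: "(\<Prod>i\<in>{1..int n}. i) = fact n"
  by (induction n) (simp_all only: int_interval_Suc, auto simp: algebra_simps)

lemma prod_shifted_interval_fact:
  "(\<Prod>i\<in>{1..int r}. int n + i) * fact n = fact (n + r)"
proof (induction r)
  case (Suc r)
  have "(\<Prod>i\<in>{1..int (Suc r)}. int n + i) * fact n
      = (int n + int r + 1) * ((\<Prod>i\<in>{1..int r}. int n + i) * fact n)"
    unfolding int_interval_Suc by (subst prod.insert) (simp_all add: mult.assoc)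
  also have "\<dots> = (int n + int r + 1) * fact (n + r)"
    by (simp only: Suc.IH)
  finally show ?case
    by (simp add: algebra_simps)
qed simp

text \<open>Since \<open>(n+1)^2 - i^2 = (n+1-i) (n+1+i)\<close>, the factors run over
  \<open>1..n\<close> and \<open>n+2..2n+1\<close>; the factor \<open>n + 1\<close> fills the
  gap.\<close>

lemma prod_square_diff_fact:
  "(int n + 1) * (\<Prod>i\<in>{1..int n}. (int n + 1)\<^sup>2 - i\<^sup>2) = fact (2 * n + 1)"
proof -
  have rev: "(\<Prod>i\<in>{1..int n}. int n + 1 - i) = fact n"
    unfolding prod_int_interval_fact[symmetric]
    by (rule prod.reindex_bij_witness[of _ "\<lambda>i. int n + 1 - i" "\<lambda>i. int n + 1 - i"]) auto
  have "(\<Prod>i\<in>{1..int n}. (int n + 1)\<^sup>2 - i\<^sup>2)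
      = (\<Prod>i\<in>{1..int n}. (int n + 1 - i) * (int (n + 1) + i))"
    by (rule prod.cong) (simp_all add: power2_eq_square algebra_simps)
  also have "\<dots> = fact n * (\<Prod>i\<in>{1..int n}. int (n + 1) + i)"
    unfolding prod.distrib rev ..
  finally have "(int n + 1) * (\<Prod>i\<in>{1..int n}. (int n + 1)\<^sup>2 - i\<^sup>2)
      = (int n + 1) * (fact n * (\<Prod>i\<in>{1..int n}. int (n + 1) + i))"
    by (rule arg_cong)
  also have "\<dots> = (\<Prod>i\<in>{1..int n}. int (n + 1) + i) * fact (n + 1)"
    by simp
  also have "\<dots> = fact (n + 1 + n)"
    by (rule prod_shifted_interval_fact)
  also have "n + 1 + n = 2 * n + 1"
    by simp
  finally show ?thesis .
qed

text \<open>This is the Vandermonde product of the squares. Passing from \<open>n\<close> to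
  \<open>n + 1\<close> adds the factors of \<open>prod_square_diff_fact\<close>, and
  \<open>fact n\<close> collects the gap factors.\<close>

lemma pairprod_square_diff_fact:
  "pairprod (\<lambda>i j. \<bar>i\<^sup>2 - j\<^sup>2\<bar>) {1..int n} * fact n = (\<Prod>j<n. fact (2 * j + 1) :: int)"
proof (induction n)
  case (Suc n)
  have "pairprod (\<lambda>i j. \<bar>i\<^sup>2 - j\<^sup>2\<bar>) {1..int (Suc n)}
      = pairprod (\<lambda>i j. \<bar>i\<^sup>2 - j\<^sup>2\<bar>) {1..int n} * (\<Prod>i\<in>{1..int n}. \<bar>i\<^sup>2 - (int n + 1)\<^sup>2\<bar>)"
    unfolding int_interval_Suc by (rule pairprod_insert) (auto simp: abs_minus_commute)
  also have "(\<Prod>i\<in>{1..int n}. \<bar>i\<^sup>2 - (int n + 1)\<^sup>2\<bar>) = (\<Prod>i\<in>{1..int n}. (int n + 1)\<^sup>2 - i\<^sup>2)"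

  proof (rule prod.cong)
    fix i assume "i \<in> {1..int n}"
    then have "i\<^sup>2 \<le> (int n + 1)\<^sup>2"
      by (intro power_mono) auto
    then show "\<bar>i\<^sup>2 - (int n + 1)\<^sup>2\<bar> = (int n + 1)\<^sup>2 - i\<^sup>2"
      by linarith
  qed simp
  finally have "pairprod (\<lambda>i j. \<bar>i\<^sup>2 - j\<^sup>2\<bar>) {1..int (Suc n)} * fact (Suc n)
     = (pairprod (\<lambda>i j. \<bar>i\<^sup>2 - j\<^sup>2\<bar>) {1..int n} * fact n)
       * ((int n + 1) * (\<Prod>i\<in>{1..int n}. (int n + 1)\<^sup>2 - i\<^sup>2))"
    by (simp add: algebra_simps)
  then show ?case
    by (simp only: Suc.IH prod_square_diff_fact prod.lessThan_Suc)
qed simp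

text \<open>The product is the derivative, at the root \<open>a^2\<close>, of the polynomial with
  roots \<open>j^2\<close>. The factors \<open>a - j\<close> give \<open>(a-1)!\<close> and
  \<open>(-1)^r r!\<close>; then \<open>(a-1)!\<close> and \<open>2 a^2\<close> complete the factors
  \<open>a + j\<close> to \<open>(2a + r)!\<close>.\<close>

lemma prod_square_diff_omit:
  assumes "1 \<le> a"
  shows "2 * (int a)\<^sup>2 * (\<Prod>j\<in>{1..int (a + r)} - {int a}. (int a)\<^sup>2 - j\<^sup>2)
           = (- 1) ^ r * fact r * fact (2 * a + r)"
proof (induction r)
  case 0
  obtain b where b: "a = Suc b"
    using assms by (cases a) auto
  have "{1..int (Suc b)} - {int (Suc b)} = {1..int b}"
    by auto
  then have "2 * (int a)\<^sup>2 * (\<Prod>j\<in>{1..int (a + 0)} - {int a}. (int a)\<^sup>2 - j\<^sup>2)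
      = 2 * int a * ((int b + 1) * (\<Prod>j\<in>{1..int b}. (int b + 1)\<^sup>2 - j\<^sup>2))"
    by (simp add: b power2_eq_square algebra_simps)
  also have "\<dots> = fact (2 * a)"
    by (simp only: prod_square_diff_fact) (simp add: b algebra_simps)
  finally show ?case by simp
next
  case (Suc r)
  let ?P = "\<lambda>r. \<Prod>j\<in>{1..int (a + r)} - {int a}. (int a)\<^sup>2 - j\<^sup>2"
  have "{1..int (a + Suc r)} - {int a} = insert (int a + int r + 1) ({1..int (a + r)} - {int a})"
    by auto
  then have "?P (Suc r) = ((int a)\<^sup>2 - (int a + int r + 1)\<^sup>2) * ?P r"
    by simp
  also have "(int a)\<^sup>2 - (int a + int r + 1)\<^sup>2 = - (int r + 1) * (2 * int a + int r + 1)"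
    by (simp add: power2_eq_square algebra_simps)
  finally have "2 * (int a)\<^sup>2 * ?P (Suc r)
      = - (int r + 1) * (2 * int a + int r + 1) * (2 * (int a)\<^sup>2 * ?P r)"
    by (simp only: mult.assoc mult.left_commute)
  also have "\<dots> = - (int r + 1) * (2 * int a + int r + 1) * ((- 1) ^ r * fact r * fact (2 * a + r))"
    by (simp only: Suc.IH)
  also have "\<dots> = (- 1) ^ Suc r * fact (Suc r) * fact (2 * a + Suc r)"
    by (simp add: algebra_simps)
  finally show ?case .
qed

section \<open>Residues up to sign\<close>

locale odd_prime =
  fixes p n :: nat
  assumes prime: "prime p" and p_eq: "p = 2 * n + 1"
begin

text \<open>One representative of each class of nonzero residues modulo sign; \<open>tilde p\<close>
  selects it.\<close>

abbreviation "I \<equiv> {1..int n}"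

lemma n_pos: "n \<ge> 1"
  using prime p_eq by (cases n) auto

lemma prime_int: "prime (int p)"
  using prime by simp

lemma not_dvd_interval: "i \<in> I \<Longrightarrow> \<not> int p dvd i"
  using zdvd_not_zless[of i "int p"] p_eq by auto

lemma square_cong_iff: "[x\<^sup>2 = y\<^sup>2] (mod int p) \<longleftrightarrow> [x = y] (mod int p) \<or> [x = - y] (mod int p)"
proof -
  have "x\<^sup>2 - y\<^sup>2 = (x - y) * (x + y)"
    by (simp add: power2_eq_square algebra_simps)
  then show ?thesis
    by (simp add: cong_iff_dvd_diff prime_dvd_mult_iff[OF prime_int])
qed

text \<open>Both \<open>i + j\<close> and the absolute value of \<open>i - j\<close> are below
  \<open>p\<close>, so divisibility of either one by \<open>p\<close> forces
  \<open>i = j\<close>.\<close>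

lemma square_cong_interval:
  assumes "i \<in> I" "j \<in> I" "[i\<^sup>2 = j\<^sup>2] (mod int p)"
  shows "i = j"
proof -
  have "int p dvd i - j \<or> int p dvd i + j"
    using assms(3) unfolding square_cong_iff by (simp add: cong_iff_dvd_diff)
  then show ?thesis
    using assms(1,2) p_eq zdvd_not_zless[of "i + j" "int p"] zdvd_not_zless[of "i - j" "int p"]
      zdvd_not_zless[of "j - i" "int p"]
    by (cases i j rule: linorder_cases) (auto simp: dvd_diff_commute)
qed

lemma cong_mult_cancel:
  assumes "\<not> int p dvd c" "[c * x = c * y] (mod int p)"
  shows "[x = y] (mod int p)"
proof -
  have "int p dvd c * (x - y)"
    using assms(2) by (simp add: cong_iff_dvd_diff algebra_simps)
  then show ?thesis
    using assms(1) by (simp add: cong_iff_dvd_diff prime_dvd_mult_iff[OF prime_int])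
qed

text \<open>As \<open>p > 2\<close>, the residues of 1 and -1 differ. In this way a sign evaluated
  modulo \<open>p\<close> is known as an integer.\<close>

lemma cong_sign_eq:
  fixes x y :: int
  assumes "[x = y] (mod int p)" "\<bar>x\<bar> = 1" "\<bar>y\<bar> = 1"
  shows "x = y"
proof -
  have "\<not> int p dvd 2"
    using p_eq n_pos zdvd_not_zless[of 2 "int p"] by auto
  then show ?thesis
    using assms by (auto simp: abs_if cong_iff_dvd_diff split: if_splits)
qed

lemma tilde_square: "[(tilde p x)\<^sup>2 = x\<^sup>2] (mod int p)"
  unfolding square_cong_iff tilde_def by (auto simp: cong_def mod_diff_left_eq mod_minus_eq mod_simps)

lemma tilde_in_interval:
  assumes "\<not> int p dvd x"
  shows "tilde p x \<in> I"
proof -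
  have "0 \<le> x mod int p" "x mod int p < int p" "x mod int p \<noteq> 0"
    using assms p_eq by (auto simp: dvd_eq_mod_eq_0)
  then have "1 \<le> x mod int p" "x mod int p \<le> 2 * int n"
    using p_eq by linarith+
  then show ?thesis
    unfolding tilde_def using p_eq by auto
qed

text \<open>An element of \<open>I\<close> is determined by its square modulo \<open>p\<close>, so
  squares suffice to identify \<open>tilde\<close>.\<close>

lemma tilde_eqI:
  assumes "i \<in> I" "[i\<^sup>2 = x\<^sup>2] (mod int p)"
  shows "tilde p x = i"
proof -
  have "\<not> int p dvd i\<^sup>2"
    using not_dvd_interval[OF assms(1)] prime_dvd_power_iff[OF prime_int] by auto
  then have "\<not> int p dvd x\<^sup>2"
    using assms(2) by (simp add: cong_dvd_iff)
  then have "\<not> int p dvd x"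
    by (auto simp: power2_eq_square)
  then show ?thesis
    using square_cong_interval[OF tilde_in_interval assms(1)] tilde_square assms(2)
    by (meson cong_sym cong_trans)
qed

text \<open>Multiplication by a unit permutes the residues up to sign, as in Gauss's lemma. This
  justifies the substitutions in sums and products over \<open>I\<close> below.\<close>

lemma tilde_mult_bij:
  assumes t: "\<not> int p dvd t"
  shows "bij_betw (\<lambda>i. tilde p (t * i)) I I"
proof -
  have "inj_on (\<lambda>i. tilde p (t * i)) I"
  proof (rule inj_onI)
    fix i j assume ij: "i \<in> I" "j \<in> I" "tilde p (t * i) = tilde p (t * j)"
    have "[(t * i)\<^sup>2 = (t * j)\<^sup>2] (mod int p)"
      using tilde_square[of "t * i"] tilde_square[of "t * j"] ij(3) by (metis cong_sym cong_trans)
    then have "[t\<^sup>2 * i\<^sup>2 = t\<^sup>2 * j\<^sup>2] (mod int p)"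
      by (simp add: power_mult_distrib)
    moreover have "\<not> int p dvd t\<^sup>2"
      using t prime_dvd_power_iff[OF prime_int] by auto
    ultimately show "i = j"
      using cong_mult_cancel square_cong_interval ij by blast
  qed
  moreover have "(\<lambda>i. tilde p (t * i)) ` I \<subseteq> I"
    using tilde_in_interval not_dvd_interval t by (auto simp: prime_dvd_mult_iff[OF prime_int] simp del: atLeastAtMost_iff)
  ultimately show ?thesis
    by (simp add: bij_betw_def endo_inj_surj)
qed

section \<open>Wilson's theorem and products of differences of squares modulo
  \<open>p\<close>\<close>

lemma wilson_split:
  assumes "r \<le> p - 1"
  shows "[fact r * fact (p - 1 - r) = (- 1) ^ (r + 1)] (mod int p)"
  using assms
proof (induction r)
  case 0
  then show ?case
    using wilson_theorem[OF prime] by simp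
next
  case (Suc r)
  define d where "d = p - 1 - Suc r"
  have d: "p - 1 - r = Suc d" "int p = int r + int d + 2"
    using Suc.prems d_def by auto
  \<comment> \<open>\<open>fact (Suc r) * fact d\<close> and \<open>fact r * fact (Suc d)\<close>
    are \<open>r + 1\<close> and \<open>d + 1\<close> times \<open>fact r * fact d\<close>, and
    \<open>r + d + 2 = p\<close>.\<close>
  have "fact (Suc r) * fact d = - (fact r * fact (Suc d)) + int p * (fact r * fact d :: int)"
    by (simp add: d(2) algebra_simps)
  then have "[fact (Suc r) * fact d = - (fact r * fact (Suc d) :: int)] (mod int p)"
    by (simp add: cong_iff_dvd_diff)
  also have "[- (fact r * fact (Suc d) :: int) = - ((- 1) ^ (r + 1))] (mod int p)"
    using Suc.IH Suc.prems d(1) by (simp only: cong_minus_minus_iff)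
  finally show ?case
    by (simp add: d_def)
qed

text \<open>With \<open>r = n - a\<close> the factorials of \<open>prod_square_diff_omit\<close>
  become \<open>r!\<close> and \<open>(p - 1 - r)!\<close>, since \<open>2 a + r = n + a\<close>.
  This agrees with the derivative of \<open>X^n - 1\<close>, whose roots modulo \<open>p\<close> are
  the squares.\<close>

lemma prod_square_diff_omit_cong:
  assumes "a \<in> I"
  shows "[2 * a\<^sup>2 * (\<Prod>j\<in>I - {a}. a\<^sup>2 - j\<^sup>2) = - 1] (mod int p)"
proof -
  define b r where "b = nat a" and "r = n - nat a"
  have b: "a = int b" "1 \<le> b" "n = b + r" "p - 1 - r = 2 * b + r" "r \<le> p - 1"
    using assms p_eq unfolding b_def r_def by (simp_all, linarith+)
  have "2 * a\<^sup>2 * (\<Prod>j\<in>I - {a}. a\<^sup>2 - j\<^sup>2) = (- 1) ^ r * (fact r * fact (p - 1 - r))"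
    using prod_square_diff_omit[OF b(2), of r] unfolding b(1) b(4) by (simp only: b(3) mult.assoc)
  also have "[\<dots> = (- 1) ^ r * (- 1) ^ (r + 1)] (mod int p)"
    by (rule cong_scalar_left) (rule wilson_split[OF b(5)])
  also have "(- 1) ^ r * (- 1) ^ (r + 1) = (- 1 :: int)"
    by (simp flip: power_add)
  finally show ?thesis .
qed

lemma pairprod_square_diff_coprime: "\<not> int p dvd pairprod (\<lambda>i j. \<bar>i\<^sup>2 - j\<^sup>2\<bar>) I"
proof -
  have "\<not> int p dvd \<bar>i\<^sup>2 - j\<^sup>2\<bar>" if "i \<in> I" "j \<in> I" "i < j" for i j
    using square_cong_interval[OF that(1,2)] that(3) by (metis cong_iff_dvd_diff dvd_abs_iff less_irrefl)
  then show ?thesis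
    unfolding pairprod_def prime_dvd_prod_iff[OF finite_pairs[OF finite_atLeastAtMost_int] prime_int]
    by (auto simp del: atLeastAtMost_iff dvd_abs_iff)
qed

text \<open>The factorials of \<open>2 j + 1\<close> and \<open>2 (n - 1 - j) + 1\<close> multiply
  to 1 by \<open>wilson_split\<close>, as these odd arguments add up to \<open>p - 1\<close>. For
  even \<open>n\<close> this pairing leaves no middle factor.\<close>

lemma pairprod_square_diff_cong:
  assumes "even n"
  shows "[pairprod (\<lambda>i j. \<bar>i\<^sup>2 - j\<^sup>2\<bar>) I * fact n = 1] (mod int p)"
proof -
  obtain k where k: "n = k + k"
    using assms by (metis evenE mult_2)
  let ?F = "\<lambda>j. fact (2 * j + 1) :: int"
  have "(\<Prod>j<n. ?F j) = (\<Prod>j<k. ?F j) * (\<Prod>j\<in>{k..<k + k}. ?F j)"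
    unfolding k lessThan_atLeast0 by (rule prod.atLeastLessThan_concat[symmetric]) auto
  also have "(\<Prod>j\<in>{k..<k + k}. ?F j) = (\<Prod>j<k. ?F (n - 1 - j))"
    by (rule prod.reindex_bij_witness[of _ "\<lambda>j. n - 1 - j" "\<lambda>j. n - 1 - j"]) (auto simp: k)
  also have "(\<Prod>j<k. ?F j) * \<dots> = (\<Prod>j<k. ?F j * ?F (n - 1 - j))"
    by (simp add: prod.distrib)
  also have "[\<dots> = (\<Prod>j<k. 1)] (mod int p)"
  proof (rule cong_prod)
    fix j assume "j \<in> {..<k}"
    then have "2 * j + 1 \<le> p - 1" "p - 1 - (2 * j + 1) = 2 * (n - 1 - j) + 1"
      using p_eq k by auto
    then show "[?F j * ?F (n - 1 - j) = 1] (mod int p)"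
      using wilson_split[of "2 * j + 1"] by (simp del: fact_Suc)
  qed
  finally show ?thesis
    unfolding pairprod_square_diff_fact by simp
qed

text \<open>Writing the condition as a product makes the sign symmetric in \<open>i\<close> and
  \<open>j\<close>. Equal values of \<open>tilde\<close> get the sign 1, as they are no inversion in
  \<open>s'\<close>.\<close>

definition inversion_sign :: "int \<Rightarrow> int \<Rightarrow> int \<Rightarrow> int" where
  "inversion_sign m i j =
     (if (i - j) * (tilde p (m * i\<^sup>2) - tilde p (m * j\<^sup>2)) < 0 then - 1 else 1)"

lemma inversion_sign_sym: "inversion_sign m i j = inversion_sign m j i"
proof -
  have "(i - j) * (tilde p (m * i\<^sup>2) - tilde p (m * j\<^sup>2))
      = (j - i) * (tilde p (m * j\<^sup>2) - tilde p (m * i\<^sup>2))"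
    by (simp add: algebra_simps)
  then show ?thesis
    unfolding inversion_sign_def by simp
qed

lemma inversion_sign_mult_abs:
  "inversion_sign m i j * \<bar>(i - j) * (tilde p (m * i\<^sup>2) - tilde p (m * j\<^sup>2))\<bar>
     = (i - j) * (tilde p (m * i\<^sup>2) - tilde p (m * j\<^sup>2))"
  unfolding inversion_sign_def by (simp add: abs_if)

lemma s'_eq_pairprod: "(- 1) ^ s' p m = pairprod (inversion_sign m) I"
proof -
  let ?f = "\<lambda>i. tilde p (m * i\<^sup>2)"
  let ?S = "{(i, j). 1 \<le> i \<and> i < j \<and> j \<le> (p - 1) div 2 \<and> ?f (int i) > ?f (int j)}"
  let ?T = "{(i, j). i \<in> I \<and> j \<in> I \<and> i < j \<and> ?f i > ?f j}"
  have "?T = (\<lambda>(i, j). (int i, int j)) ` ?S"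
  proof (intro equalityI subsetI)
    fix x assume "x \<in> ?T"
    then have "(nat (fst x), nat (snd x)) \<in> ?S" "x = (\<lambda>(i, j). (int i, int j)) (nat (fst x), nat (snd x))"
      using p_eq by auto
    then show "x \<in> (\<lambda>(i, j). (int i, int j)) ` ?S"
      by blast
  qed (use p_eq in auto)
  moreover have "inj_on (\<lambda>(i, j). (int i, int j)) ?S"
    by (auto simp: inj_on_def)
  ultimately have "card ?T = s' p m"
    unfolding s'_def by (simp only: card_image)
  moreover have "pairprod (inversion_sign m) I = pairprod (\<lambda>i j. if ?f i > ?f j then - 1 else 1) I"
    by (rule pairprod_cong) (auto simp: inversion_sign_def mult_less_0_iff)
  moreover have "\<dots> = (- 1) ^ card ?T"
    by (rule pairprod_sign) simp
  ultimately show ?thesis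
    by simp
qed

section \<open>Primes congruent to 3 modulo 4\<close>

lemma p_gt_2: "p > 2"
  using p_eq n_pos by simp

lemma euler: "[Legendre x (int p) = x ^ n] (mod int p)"
  using euler_criterion[OF prime p_gt_2, of x] p_eq by simp

text \<open>Euler's criterion gives a congruence, and two symbols differ by at most 2, which is less
  than \<open>p\<close>.\<close>

lemma Legendre_eqI:
  assumes "[x ^ n = y ^ n] (mod int p)"
  shows "Legendre x (int p) = Legendre y (int p)"
proof -
  have "[Legendre x (int p) = Legendre y (int p)] (mod int p)"
    using euler assms by (meson cong_sym cong_trans)
  then have "int p dvd \<bar>Legendre x (int p) - Legendre y (int p)\<bar>"
    by (simp add: cong_iff_dvd_diff)
  moreover have "\<bar>Legendre x (int p) - Legendre y (int p)\<bar> \<le> 2"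
    by (auto simp: Legendre_def)
  ultimately have "\<bar>Legendre x (int p) - Legendre y (int p)\<bar> = 0"
    using p_gt_2 zdvd_imp_le by fastforce
  then show ?thesis by simp
qed

lemma square_power_cong_1:
  assumes "\<not> int p dvd x"
  shows "[(x\<^sup>2) ^ n = 1] (mod int p)"
proof -
  have "\<not> [x\<^sup>2 = 0] (mod int p)"
    using assms prime_dvd_power_iff[OF prime_int] by (auto simp: cong_0_iff)
  then have "Legendre (x\<^sup>2) (int p) = 1"
    unfolding Legendre_def QuadRes_def using cong_refl[of "x\<^sup>2"] by metis
  then show ?thesis
    using euler[of "x\<^sup>2"] by (simp add: cong_sym_eq)
qed

lemma Legendre_scale:
  assumes "\<not> int p dvd c" "[x = c\<^sup>2 * y] (mod int p)"
  shows "Legendre x (int p) = Legendre y (int p)"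
proof (rule Legendre_eqI)
  have "[x ^ n = (c\<^sup>2 * y) ^ n] (mod int p)"
    using assms(2) by (rule cong_pow)
  also have "(c\<^sup>2 * y) ^ n = (c\<^sup>2) ^ n * y ^ n"
    by (rule power_mult_distrib)
  also have "[\<dots> = 1 * y ^ n] (mod int p)"
    by (rule cong_scalar_right) (rule square_power_cong_1[OF assms(1)])
  finally show "[x ^ n = y ^ n] (mod int p)"
    by simp
qed

text \<open>Otherwise \<open>x^2\<close> would be congruent to \<open>- y^2\<close> with
  \<open>y\<close> a unit; raising to the odd power \<open>n\<close> makes 1 congruent to
  -1.\<close>

lemma sum_squares_not_dvd:
  assumes "odd n" "\<not> int p dvd x"
  shows "\<not> int p dvd x\<^sup>2 + y\<^sup>2"
proof
  assume *: "int p dvd x\<^sup>2 + y\<^sup>2"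
  then have yx: "[x\<^sup>2 = - (y\<^sup>2)] (mod int p)"
    by (simp add: cong_iff_dvd_diff)
  have "\<not> int p dvd y"
  proof
    assume "int p dvd y"
    then have "int p dvd y\<^sup>2"
      by (simp add: power2_eq_square)
    then have "int p dvd x\<^sup>2"
      using * by (simp add: dvd_add_left_iff)
    then show False
      using assms(2) prime_dvd_power[OF prime_int] by blast
  qed
  then have "[(y\<^sup>2) ^ n = 1] (mod int p)" "[(x\<^sup>2) ^ n = 1] (mod int p)"
    using square_power_cong_1 assms(2) by auto
  moreover have "[(x\<^sup>2) ^ n = (- (y\<^sup>2)) ^ n] (mod int p)"
    using yx by (rule cong_pow)
  moreover have "(- (y\<^sup>2)) ^ n = - ((y\<^sup>2) ^ n)"
    using assms(1) by (simp add: power_minus_odd)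
  ultimately have "[1 = - (1 :: int)] (mod int p)"
    by (metis cong_minus_minus_iff cong_sym cong_trans)
  then show False
    using cong_sign_eq[of 1 "- 1"] by simp
qed

section \<open>Counting nonresidues among sums of two squares\<close>

lemma power_sum_cong_0:
  assumes "0 < r" "r < n"
  shows "[(\<Sum>t\<in>I. (t\<^sup>2) ^ r) = 0] (mod int p)"
proof -
  \<comment> \<open>A primitive root \<open>g\<close> has order \<open>2 n > 2 r\<close>, so
    \<open>g ^ (2 * r) - 1\<close> is a unit.\<close>
  obtain g where g: "residue_primroot p g"
    using prime_primitive_root_exists[of p] prime prime_gt_1_nat by auto
  have "ord p g = 2 * n" "coprime p g"
    using g totient_prime[OF prime] p_eq by (auto simp: residue_primroot_def)
  moreover from this have "\<not> [g ^ (2 * r) = 1] (mod p)"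
    using assms by (metis ord_divides dvd_imp_le mult_le_cancel1 mult_pos_pos not_le zero_less_numeral)
  ultimately have g1: "\<not> int p dvd int g ^ (2 * r) - 1" and g0: "\<not> int p dvd int g"
    using prime cong_int_iff[of "g ^ (2 * r)" 1 p] coprime_absorb_left[of p g] prime_gt_1_nat[OF prime]
    by (auto simp: cong_iff_dvd_diff)
  let ?S = "\<Sum>t\<in>I. (t\<^sup>2) ^ r"
  \<comment> \<open>Substituting \<open>g t\<close> for \<open>t\<close> permutes \<open>I\<close>
    up to sign and multiplies the sum by \<open>g ^ (2 * r)\<close>, so the sum vanishes modulo
    \<open>p\<close>.\<close>
  have "?S = (\<Sum>t\<in>I. ((tilde p (int g * t))\<^sup>2) ^ r)"
    by (rule sum.reindex_bij_betw[OF tilde_mult_bij[OF g0], symmetric])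
  also have "[\<dots> = (\<Sum>t\<in>I. ((int g * t)\<^sup>2) ^ r)] (mod int p)"
    by (intro cong_sum cong_pow tilde_square)
  also have "(\<Sum>t\<in>I. ((int g * t)\<^sup>2) ^ r) = int g ^ (2 * r) * ?S"
    by (simp add: sum_distrib_left power_mult_distrib power_mult)
  finally have "int p dvd (int g ^ (2 * r) - 1) * ?S"
    by (simp add: cong_iff_dvd_diff algebra_simps dvd_diff_commute)
  then show ?thesis
    using g1 by (simp add: prime_dvd_mult_iff[OF prime_int] cong_0_iff)
qed

text \<open>Euler's criterion turns the symbols into \<open>(t^2 + 1)^n\<close>, and in the binomial
  expansion only the power sums for the exponents 0 and \<open>n\<close> survive. They contribute
  \<open>2 n = p - 1\<close>, and the size of the sum fixes its value.\<close>

lemma sum_Legendre_Suc_square: "(\<Sum>t\<in>I. Legendre (t\<^sup>2 + 1) (int p)) = - 1"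
proof -
  let ?S = "\<lambda>r. \<Sum>t\<in>I. (t\<^sup>2) ^ r"
  let ?L = "\<Sum>t\<in>I. Legendre (t\<^sup>2 + 1) (int p)"
  have "[?L = (\<Sum>t\<in>I. (t\<^sup>2 + 1) ^ n)] (mod int p)"
    by (intro cong_sum euler)
  also have "(\<Sum>t\<in>I. (t\<^sup>2 + 1) ^ n) = (\<Sum>t\<in>I. \<Sum>r\<le>n. int (n choose r) * (t\<^sup>2) ^ r)"
    by (simp add: binomial_ring)
  also have "\<dots> = (\<Sum>r\<le>n. int (n choose r) * ?S r)"
    by (subst sum.swap) (simp add: sum_distrib_left)
  also have "[\<dots> = (\<Sum>r\<le>n. if r = 0 \<or> r = n then int n else 0)] (mod int p)"
  proof (rule cong_sum)
    fix r assume r: "r \<in> {..n}"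
    consider "r = 0" | "r = n" "r \<noteq> 0" | "0 < r" "r < n"
      using r by fastforce
    then show "[int (n choose r) * ?S r = (if r = 0 \<or> r = n then int n else 0)] (mod int p)"
    proof cases
      case 2
      have "[?S n = (\<Sum>t\<in>I. 1)] (mod int p)"
        by (rule cong_sum) (rule square_power_cong_1, rule not_dvd_interval)
      then show ?thesis
        using 2 by simp
    next
      case 3
      then show ?thesis
        using cong_scalar_left[OF power_sum_cong_0[OF 3], of "int (n choose r)"] by simp
    qed simp
  qed
  also have "(\<Sum>r\<le>n. if r = 0 \<or> r = n then int n else 0) = (\<Sum>r\<in>{0, n}. int n)"
    by (rule sum.mono_neutral_cong_right) auto
  also have "\<dots> = int p - 1"
    using p_eq n_pos by simp
  finally have "int p dvd \<bar>?L + 1\<bar>"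
    by (simp add: cong_iff_dvd_diff) (metis diff_add_cancel dvd_add_triv_right_iff add.commute diff_diff_eq2)
  moreover have "\<bar>?L + 1\<bar> < int p"
  proof -
    have "\<bar>?L\<bar> \<le> (\<Sum>t\<in>I. \<bar>Legendre (t\<^sup>2 + 1) (int p)\<bar>)"
      by (rule sum_abs)
    also have "\<dots> \<le> (\<Sum>t\<in>I. 1)"
      by (rule sum_mono) (auto simp: Legendre_def)
    finally have "\<bar>?L\<bar> \<le> int n"
      by simp
    moreover have "int n + 1 < int p"
      using p_eq n_pos by simp
    ultimately show ?thesis
      by linarith
  qed
  ultimately have "\<not> 0 < \<bar>?L + 1\<bar>"
    using zdvd_not_zless by blast
  then show ?thesis
    by simp
qed

text \<open>For odd \<open>n\<close> no symbol is 0, so the sum of the symbols is \<open>n\<close>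
  minus twice the count.\<close>

lemma card_nonresidue_Suc_square:
  assumes "odd n"
  shows "2 * card {t \<in> I. Legendre (t\<^sup>2 + 1) (int p) = - 1} = n + 1"
proof -
  let ?R = "{t \<in> I. Legendre (t\<^sup>2 + 1) (int p) = - 1}"
  have "(\<Sum>t\<in>I. Legendre (t\<^sup>2 + 1) (int p))
      = (\<Sum>t\<in>I. 1 - 2 * (if Legendre (t\<^sup>2 + 1) (int p) = - 1 then 1 else 0))"
  proof (rule sum.cong)
    fix t assume "t \<in> I"
    have "\<not> int p dvd 1"
      using p_gt_2 by simp
    then have "\<not> [t\<^sup>2 + 1 = 0] (mod int p)"
      using sum_squares_not_dvd[OF assms, of 1 t] by (simp add: cong_0_iff add.commute)
    then show "Legendre (t\<^sup>2 + 1) (int p) = 1 - 2 * (if Legendre (t\<^sup>2 + 1) (int p) = - 1 then 1 else 0)"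
      by (simp add: Legendre_def)
  qed simp
  also have "\<dots> = int n - 2 * int (card ?R)"
    by (simp add: sum_subtractf sum_distrib_left[symmetric] sum.inter_filter[symmetric])
  finally show ?thesis
    using sum_Legendre_Suc_square by linarith
qed

text \<open>Substituting \<open>j = tilde p (i * t)\<close> turns \<open>i^2 + j^2\<close> into
  \<open>i^2 (t^2 + 1)\<close> modulo \<open>p\<close>, and the square factor leaves the symbol
  unchanged.\<close>

lemma card_nonresidue_sum_squares:
  assumes "odd n" "i \<in> I"
  shows "2 * card {j \<in> I. Legendre (i\<^sup>2 + j\<^sup>2) (int p) = - 1} = n + 1"
proof -
  note i = not_dvd_interval[OF assms(2)]
  have "Legendre (i\<^sup>2 + (tilde p (i * t))\<^sup>2) (int p) = Legendre (t\<^sup>2 + 1) (int p)" for t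
  proof (rule Legendre_scale[OF i])
    have "[i\<^sup>2 + (tilde p (i * t))\<^sup>2 = i\<^sup>2 + (i * t)\<^sup>2] (mod int p)"
      by (intro cong_add cong_refl tilde_square)
    then show "[i\<^sup>2 + (tilde p (i * t))\<^sup>2 = i\<^sup>2 * (t\<^sup>2 + 1)] (mod int p)"
      by (simp add: algebra_simps power_mult_distrib)
  qed
  note eq = this
  let ?h = "\<lambda>t. tilde p (i * t)"
  have h: "inj_on ?h I" "?h ` I = I"
    using tilde_mult_bij[OF i] by (auto simp: bij_betw_def)
  have "{j \<in> I. Legendre (i\<^sup>2 + j\<^sup>2) (int p) = - 1}
      = {j \<in> ?h ` I. Legendre (i\<^sup>2 + j\<^sup>2) (int p) = - 1}"
    by (simp only: h(2))
  also have "\<dots> = ?h ` {t \<in> I. Legendre (t\<^sup>2 + 1) (int p) = - 1}"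
    unfolding eq[symmetric] by blast
  finally have "card {j \<in> I. Legendre (i\<^sup>2 + j\<^sup>2) (int p) = - 1}
      = card {t \<in> I. Legendre (t\<^sup>2 + 1) (int p) = - 1}"
    using inj_on_subset[OF h(1)] by (metis (no_types, lifting) card_image mem_Collect_eq subsetI)
  then show ?thesis
    using card_nonresidue_Suc_square[OF assms(1)] by simp
qed

text \<open>Ordered pairs are counted row by row. Every unordered pair occurs twice, and a diagonal
  pair has the symbol of \<open>2 i^2\<close>, hence that of 2.\<close>

lemma card_nonresidue_pairs:
  assumes "odd n"
  defines "N \<equiv> card {(i, j). i \<in> I \<and> j \<in> I \<and> i < j \<and> Legendre (i\<^sup>2 + j\<^sup>2) (int p) = - 1}"
  shows "even N \<longleftrightarrow> even ((p + 1) div 8)"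
proof -
  let ?Q = "\<lambda>i j. Legendre (i\<^sup>2 + j\<^sup>2) (int p) = - 1"
  let ?U = "{(i, j). i \<in> I \<and> j \<in> I \<and> i < j \<and> ?Q i j}"
  let ?V = "{(i, j). i \<in> I \<and> j \<in> I \<and> j < i \<and> ?Q i j}"
  let ?W = "{(i, j). i \<in> I \<and> i = j \<and> ?Q i j}"
  let ?T = "SIGMA i:I. {j \<in> I. ?Q i j}"
  have fin: "finite ?U" "finite ?V" "finite ?W"
    by (rule finite_subset[of _ "I \<times> I"]; auto)+
  have "?V = prod.swap ` ?U"
    by (auto simp: image_iff add.commute)
  then have V: "card ?V = N"
    unfolding N_def by (simp only: card_image[OF inj_swap])
  define d where "d = (if Legendre 2 (int p) = - 1 then 1 else 0 :: nat)"
  have "?Q i i \<longleftrightarrow> d = 1" if "i \<in> I" for i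
    using Legendre_scale[OF not_dvd_interval[OF that], of "i\<^sup>2 + i\<^sup>2" 2] by (auto simp: d_def mult_2_right)
  then have "?W = (if d = 1 then (\<lambda>i. (i, i)) ` I else {})"
    by (auto simp del: atLeastAtMost_iff)
  then have W: "card ?W = n * d"
    by (auto simp: d_def card_image inj_on_def)
  have "?T = ?U \<union> ?V \<union> ?W"
    by auto
  moreover have "(?U \<union> ?V) \<inter> ?W = {}" "?U \<inter> ?V = {}"
    by auto
  ultimately have "card ?T = N + N + n * d"
    using V W fin N_def by (simp add: card_Un_disjoint)
  moreover have "card ?T = (\<Sum>i\<in>I. card {j \<in> I. ?Q i j})"
    by (rule card_SigmaI) (simp_all del: atLeastAtMost_iff)
  ultimately have "4 * N + 2 * n * d = (\<Sum>i\<in>I. 2 * card {j \<in> I. ?Q i j})"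
    by (simp add: sum_distrib_left[symmetric])
  also have "\<dots> = n * (n + 1)"
    using card_nonresidue_sum_squares[OF assms(1)] by simp
  finally have *: "4 * N + 2 * n * d = n * (n + 1)" .
  obtain q where q: "n = 2 * q + 1"
    using assms(1) by (elim oddE)
  have "2 * N + n * d = n * (q + 1)"
    using * q by (simp add: algebra_simps)
  then have "int (2 * N + n * d) = int (n * (q + 1))"
    by (rule arg_cong)
  then have N: "2 * int N = int n * (int q + 1 - int d)"
    unfolding right_diff_distrib distrib_left by simp
  have "even (int n * (int q + 1 - int d))"
    unfolding N[symmetric] by simp
  then have "even (int q + 1 - int d)"
    using assms(1) by simp
  then obtain e where e: "int q + 1 - int d = 2 * e"
    by (elim evenE)
  then have "int N = int n * e"
    using N by simp
  then have "even (int N) \<longleftrightarrow> even (int n * e)"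
    by (rule arg_cong)
  then have "even N \<longleftrightarrow> even e"
    using assms(1) by simp
  \<comment> \<open>As \<open>d\<close> is 0 or 1, the even number \<open>q + 1 - d\<close> is
    \<open>q + 1\<close> rounded down to an even number; moreover
    \<open>p + 1 = 4 q + 4\<close>.\<close>
  moreover have "e = (int q + 1) div 2"
    using e d_def by (auto split: if_splits)
  moreover have "int ((p + 1) div 8) = (int q + 1) div 2"
    using p_eq q by (simp add: zdiv_int)
  ultimately show ?thesis
    by (metis even_of_nat)
qed

text \<open>The sum \<open>i + j\<close> and the sum of the two \<open>tilde\<close> values are
  positive, so passing to squares keeps the sign. The squares of \<open>tilde\<close> values are
  known modulo \<open>p\<close>.\<close>

lemma inversion_sign_square_diff:
  assumes "i \<in> I" "j \<in> I" "\<not> int p dvd m"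
  shows "inversion_sign m i j * (\<bar>i\<^sup>2 - j\<^sup>2\<bar> * \<bar>(tilde p (m * i\<^sup>2))\<^sup>2 - (tilde p (m * j\<^sup>2))\<^sup>2\<bar>)
           = (i\<^sup>2 - j\<^sup>2) * ((tilde p (m * i\<^sup>2))\<^sup>2 - (tilde p (m * j\<^sup>2))\<^sup>2)"
proof -
  let ?f = "\<lambda>i. tilde p (m * i\<^sup>2)"
  have f: "?f i \<in> I" if "i \<in> I" for i
    using tilde_in_interval not_dvd_interval[OF that] assms(3)
    by (auto simp: prime_dvd_mult_iff[OF prime_int] power2_eq_square simp del: atLeastAtMost_iff)
  have sq: "x\<^sup>2 - y\<^sup>2 = (x - y) * (x + y)" for x y :: int
    by (simp add: power2_eq_square algebra_simps)
  have pos: "\<bar>i + j\<bar> = i + j" "\<bar>?f i + ?f j\<bar> = ?f i + ?f j"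
    using assms(1,2) f[OF assms(1)] f[OF assms(2)] by auto
  have "inversion_sign m i j * (\<bar>i\<^sup>2 - j\<^sup>2\<bar> * \<bar>(?f i)\<^sup>2 - (?f j)\<^sup>2\<bar>)
      = (inversion_sign m i j * \<bar>(i - j) * (?f i - ?f j)\<bar>) * ((i + j) * (?f i + ?f j))"
    by (simp only: sq abs_mult pos ac_simps)
  also have "\<dots> = (i - j) * (?f i - ?f j) * ((i + j) * (?f i + ?f j))"
    by (simp only: inversion_sign_mult_abs)
  also have "\<dots> = (i\<^sup>2 - j\<^sup>2) * ((?f i)\<^sup>2 - (?f j)\<^sup>2)"
    by (simp only: sq ac_simps)
  finally show ?thesis .
qed

text \<open>If \<open>m i^2\<close> and \<open>m j^2\<close> agree up to sign, so do
  \<open>i^2\<close> and \<open>j^2\<close>, and the minus sign is excluded for odd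
  \<open>n\<close>.\<close>

lemma tilde_mult_square_bij:
  assumes "odd n" "\<not> int p dvd m"
  shows "bij_betw (\<lambda>i. tilde p (m * i\<^sup>2)) I I"
proof -
  have "inj_on (\<lambda>i. tilde p (m * i\<^sup>2)) I"
  proof (rule inj_onI)
    fix i j assume ij: "i \<in> I" "j \<in> I" "tilde p (m * i\<^sup>2) = tilde p (m * j\<^sup>2)"
    have "[(m * i\<^sup>2)\<^sup>2 = (m * j\<^sup>2)\<^sup>2] (mod int p)"
      using tilde_square[of "m * i\<^sup>2"] tilde_square[of "m * j\<^sup>2"] ij(3) by (metis cong_sym cong_trans)
    then have "[m * i\<^sup>2 = m * j\<^sup>2] (mod int p) \<or> [m * i\<^sup>2 = m * - (j\<^sup>2)] (mod int p)"
      unfolding square_cong_iff[of "m * i\<^sup>2"] by simp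
    then have "[i\<^sup>2 = j\<^sup>2] (mod int p) \<or> [i\<^sup>2 = - (j\<^sup>2)] (mod int p)"
      using cong_mult_cancel[OF assms(2)] by blast
    then show "i = j"
      using sum_squares_not_dvd[OF assms(1) not_dvd_interval[OF ij(1)], of j] square_cong_interval[OF ij(1,2)]
      by (auto simp: cong_iff_dvd_diff[of _ "- (j\<^sup>2)"])
  qed
  moreover have "(\<lambda>i. tilde p (m * i\<^sup>2)) ` I \<subseteq> I"
    using tilde_in_interval not_dvd_interval assms(2)
    by (auto simp: prime_dvd_mult_iff[OF prime_int] power2_eq_square simp del: atLeastAtMost_iff)
  ultimately show ?thesis
    by (simp add: bij_betw_def endo_inj_surj)
qed

lemma pairprod_inversion_sign_odd:
  assumes "odd n" "\<not> int p dvd m"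
  shows "pairprod (inversion_sign m) I = (- 1) ^ ((p + 1) div 8)"
proof -
  let ?f = "\<lambda>i. tilde p (m * i\<^sup>2)"
  let ?d = "\<lambda>i j :: int. \<bar>i\<^sup>2 - j\<^sup>2\<bar>"
  let ?L = "\<lambda>i j. Legendre (i\<^sup>2 + j\<^sup>2) (int p)"
  define D where "D = pairprod ?d I"
  define Z where "Z = pairprod (\<lambda>i j. m\<^sup>2 * (i\<^sup>2 + j\<^sup>2)) I"
  define \<epsilon> where "\<epsilon> = pairprod (inversion_sign m) I"
  have eps: "\<epsilon> = (- 1) ^ s' p m"
    by (simp add: \<epsilon>_def s'_eq_pairprod)
  have poly: "(x - y) * ((m * x)\<^sup>2 - (m * y)\<^sup>2) = m\<^sup>2 * (x + y) * ((x - y) * (x - y))" for x y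
    by (simp add: power2_eq_square algebra_simps)
  have f: "inj_on ?f I" "?f ` I = I"
    using tilde_mult_square_bij[OF assms] by (auto simp: bij_betw_def)
  \<comment> \<open>As \<open>?f\<close> permutes \<open>I\<close>, the differences of its squared
    values also multiply to \<open>D\<close> in absolute value, so \<open>D * D\<close> can be
    cancelled later.\<close>
  have "pairprod ?d (?f ` I) = pairprod (\<lambda>i j. ?d (?f i) (?f j)) I"
    by (rule pairprod_reindex[OF _ f(1)]) (simp_all add: abs_minus_commute)
  then have "pairprod (\<lambda>i j. ?d (?f i) (?f j)) I = D"
    unfolding D_def f(2) by (rule sym)
  then have "\<epsilon> * (D * D) = pairprod (\<lambda>i j. inversion_sign m i j * (?d i j * ?d (?f i) (?f j))) I"
    unfolding pairprod_mult by (simp only: \<epsilon>_def D_def)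
  moreover have "[pairprod (\<lambda>i j. inversion_sign m i j * (?d i j * ?d (?f i) (?f j))) I
      = pairprod (\<lambda>i j. m\<^sup>2 * (i\<^sup>2 + j\<^sup>2) * (?d i j * ?d i j)) I] (mod int p)"
  proof (rule pairprod_cong_mod)
    fix i j assume ij: "i \<in> I" "j \<in> I"
    have "[(i\<^sup>2 - j\<^sup>2) * ((?f i)\<^sup>2 - (?f j)\<^sup>2) = (i\<^sup>2 - j\<^sup>2) * ((m * i\<^sup>2)\<^sup>2 - (m * j\<^sup>2)\<^sup>2)] (mod int p)"
      by (intro cong_mult cong_diff cong_refl tilde_square)
    also have "(i\<^sup>2 - j\<^sup>2) * ((m * i\<^sup>2)\<^sup>2 - (m * j\<^sup>2)\<^sup>2) = m\<^sup>2 * (i\<^sup>2 + j\<^sup>2) * (?d i j * ?d i j)"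
      unfolding abs_mult_self_eq by (rule poly)
    finally show "[inversion_sign m i j * (?d i j * ?d (?f i) (?f j))
        = m\<^sup>2 * (i\<^sup>2 + j\<^sup>2) * (?d i j * ?d i j)] (mod int p)"
      unfolding inversion_sign_square_diff[OF ij assms(2)] .
  qed
  moreover have "pairprod (\<lambda>i j. m\<^sup>2 * (i\<^sup>2 + j\<^sup>2) * (?d i j * ?d i j)) I = Z * (D * D)"
    unfolding Z_def D_def pairprod_mult[symmetric] ..
  ultimately have "[\<epsilon> * (D * D) = Z * (D * D)] (mod int p)"
    by (simp only:)
  then have "[(D * D) * \<epsilon> = (D * D) * Z] (mod int p)"
    unfolding mult.commute[of "D * D" _] .
  moreover have "\<not> int p dvd D * D"
    using pairprod_square_diff_coprime by (simp add: D_def prime_dvd_mult_iff[OF prime_int])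
  ultimately have "[\<epsilon> = Z] (mod int p)"
    by (rule cong_mult_cancel[rotated])
  \<comment> \<open>The power \<open>n\<close> turns the factors of \<open>Z\<close> into Legendre
    symbols, from which \<open>m^2\<close> drops out, while \<open>\<epsilon>\<close> is unchanged
    because \<open>n\<close> is odd.\<close>
  then have "[\<epsilon> ^ n = Z ^ n] (mod int p)"
    by (rule cong_pow)
  also have "Z ^ n = pairprod (\<lambda>i j. (m\<^sup>2 * (i\<^sup>2 + j\<^sup>2)) ^ n) I"
    unfolding Z_def by (rule pairprod_power[symmetric])
  also have "[\<dots> = pairprod ?L I] (mod int p)"
  proof (rule pairprod_cong_mod)
    fix i j
    have "[Legendre (m\<^sup>2 * (i\<^sup>2 + j\<^sup>2)) (int p) = (m\<^sup>2 * (i\<^sup>2 + j\<^sup>2)) ^ n] (mod int p)"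
      by (rule euler)
    then show "[(m\<^sup>2 * (i\<^sup>2 + j\<^sup>2)) ^ n = ?L i j] (mod int p)"
      unfolding Legendre_scale[OF assms(2) cong_refl[of "m\<^sup>2 * (i\<^sup>2 + j\<^sup>2)"]] by (rule cong_sym)
  qed
  also have "\<epsilon> ^ n = \<epsilon>"
    using assms(1) by (cases "even (s' p m)") (simp_all add: eps)
  also have "pairprod ?L I = pairprod (\<lambda>i j. if ?L i j = - 1 then - 1 else 1) I"
  proof (rule pairprod_cong)
    fix i j assume "i \<in> I"
    then have "\<not> [i\<^sup>2 + j\<^sup>2 = 0] (mod int p)"
      using sum_squares_not_dvd[OF assms(1) not_dvd_interval] by (simp add: cong_0_iff)
    then show "?L i j = (if ?L i j = - 1 then - 1 else 1)"
      by (simp add: Legendre_def)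
  qed
  also have "\<dots> = (- 1) ^ card {(i, j). i \<in> I \<and> j \<in> I \<and> i < j \<and> ?L i j = - 1}"
    by (rule pairprod_sign) simp
  also have "\<dots> = (- 1) ^ ((p + 1) div 8)"
    using card_nonresidue_pairs[OF assms(1)] by (simp add: minus_one_power_iff)
  finally have "\<epsilon> = (- 1) ^ ((p + 1) div 8)"
    by (rule cong_sign_eq) (simp_all add: eps power_abs)
  then show ?thesis
    by (simp add: \<epsilon>_def)
qed

end

section \<open>Primes congruent to 1 modulo 4\<close>

lemma prod_parity_sign:
  "(\<Prod>i\<in>{1..int (2 * k)}. if even i then 1 else - 1 :: int) = (- 1) ^ k"
proof (induction k)
  case (Suc k)
  have "{1..int (2 * Suc k)} = insert (2 * int k + 2) (insert (2 * int k + 1) {1..int (2 * k)})"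
    by auto
  then show ?case
    using Suc.IH by simp
qed simp

locale one_mod_four_prime = odd_prime +
  fixes k :: nat and v :: int
  assumes n_eq: "n = 2 * k" and v: "[v\<^sup>2 = - 1] (mod int p)"
begin

section \<open>The fibres \<open>{a, \<sigma> a}\<close> and their representatives\<close>

definition \<sigma> :: "int \<Rightarrow> int" where "\<sigma> i = tilde p (v * i)"

text \<open>Each fibre is represented by its smaller element, so that
  \<open>(\<sigma> a)^2 - a^2\<close> is positive and equals its absolute value.\<close>

definition A :: "int set" where "A = {a \<in> I. a < \<sigma> a}"

lemma not_dvd_v: "\<not> int p dvd v"
proof
  assume "int p dvd v"
  then have "int p dvd v\<^sup>2"
    by (simp add: power2_eq_square)
  then have "int p dvd - 1"
    using v cong_dvd_iff by blast
  then show False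
    using p_gt_2 by simp
qed

lemma not_dvd_2: "\<not> int p dvd 2"
  using p_gt_2 zdvd_not_zless[of 2 "int p"] by auto

lemma \<sigma>_bij: "bij_betw \<sigma> I I"
  unfolding \<sigma>_def by (rule tilde_mult_bij[OF not_dvd_v])

lemma \<sigma>_in: "i \<in> I \<Longrightarrow> \<sigma> i \<in> I"
  using \<sigma>_bij by (rule bij_betw_apply)

lemma \<sigma>_square: "[(\<sigma> i)\<^sup>2 = - (i\<^sup>2)] (mod int p)"
proof -
  have "[(\<sigma> i)\<^sup>2 = v\<^sup>2 * i\<^sup>2] (mod int p)"
    unfolding \<sigma>_def power_mult_distrib[symmetric] by (rule tilde_square)
  also have "[v\<^sup>2 * i\<^sup>2 = - 1 * i\<^sup>2] (mod int p)"
    by (rule cong_scalar_right[OF v])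
  finally show ?thesis
    by simp
qed

lemma \<sigma>_eqI:
  assumes "i \<in> I" "j \<in> I" "[j\<^sup>2 = - (i\<^sup>2)] (mod int p)"
  shows "j = \<sigma> i"
  by (rule square_cong_interval[OF assms(2) \<sigma>_in[OF assms(1)]])
    (rule cong_trans[OF assms(3) cong_sym[OF \<sigma>_square]])

lemma \<sigma>_\<sigma>:
  assumes "i \<in> I"
  shows "\<sigma> (\<sigma> i) = i"
proof (rule \<sigma>_eqI[symmetric])
  show "[i\<^sup>2 = - ((\<sigma> i)\<^sup>2)] (mod int p)"
    using cong_minus_minus_iff[THEN iffD2, OF \<sigma>_square[of i]] by (simp add: cong_sym_eq)
qed (use assms \<sigma>_in in auto)

lemma \<sigma>_neq:
  assumes "i \<in> I"
  shows "\<sigma> i \<noteq> i"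
proof
  assume "\<sigma> i = i"
  then have "int p dvd 2 * i\<^sup>2"
    using \<sigma>_square[of i] by (simp add: cong_iff_dvd_diff)
  then show False
    using not_dvd_interval[OF assms] not_dvd_2
    by (simp add: prime_dvd_mult_iff[OF prime_int] power2_eq_square)
qed

lemma finite_A: "finite A"
  by (rule finite_subset[of _ I]) (auto simp: A_def)

lemma A_subset: "A \<subseteq> I"
  by (auto simp: A_def)

lemma inj_\<sigma>: "inj_on \<sigma> A"
  using \<sigma>_bij A_subset by (meson bij_betw_def inj_on_subset)

lemma A_disjoint: "A \<inter> \<sigma> ` A = {}"
  using \<sigma>_\<sigma> by (auto simp: A_def)

lemma I_eq: "A \<union> \<sigma> ` A = I"
proof
  show "A \<union> \<sigma> ` A \<subseteq> I"
    using A_subset \<sigma>_in by blast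
  show "I \<subseteq> A \<union> \<sigma> ` A"
  proof
    fix i assume i: "i \<in> I"
    show "i \<in> A \<union> \<sigma> ` A"
    proof (cases "i < \<sigma> i")
      case False
      then have "\<sigma> i \<in> A"
        using \<sigma>_neq[OF i] \<sigma>_\<sigma>[OF i] \<sigma>_in[OF i] unfolding A_def by auto
      then have "\<sigma> (\<sigma> i) \<in> \<sigma> ` A"
        by (rule imageI)
      then show ?thesis
        using \<sigma>_\<sigma>[OF i] by simp
    qed (use i A_def in blast)
  qed
qed

lemma card_A: "card A = k"
proof -
  have "card I = card A + card (\<sigma> ` A)"
    unfolding I_eq[symmetric] by (rule card_Un_disjoint) (use finite_A A_disjoint in auto)
  then show ?thesis
    using n_eq card_image[OF inj_\<sigma>] by simp
qed

lemma prod_over_pairs: "(\<Prod>i\<in>I. g i) = (\<Prod>a\<in>A. g a * g (\<sigma> a))"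
  unfolding I_eq[symmetric] by (rule prod_Un_involution[OF finite_A inj_\<sigma> A_disjoint])

text \<open>
  Multiplication by \<open>1 + v\<close> permutes the pairs \<open>{a, \<sigma> a}\<close> and sends \<open>{a, \<sigma> a}\<close> to
  \<open>{\<sigma> a - a, \<sigma> a + a}\<close>, up to signs modulo \<open>p\<close>.  As \<open>p\<close> is odd, a sign change \<open>x \<mapsto> p - x\<close>
  changes the parity, so that the number of sign changes is read off from the sum of \<open>{1..n}\<close>.
\<close>

lemma square_diff_pair_cong:
  fixes h \<psi> :: "int \<Rightarrow> int"
  defines "h \<equiv> \<lambda>i. (if even i then 1 else - 1) * i" and "\<psi> \<equiv> \<lambda>i. tilde p ((1 + v) * i)"
  assumes a: "a \<in> A"
  shows "[(\<sigma> a)\<^sup>2 - a\<^sup>2 = h (\<psi> a) * h (\<psi> (\<sigma> a))] (mod int p)"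
proof -
  define b where "b = \<sigma> a"
  have ab: "a \<in> I" "b \<in> I" "a < b"
    using a \<sigma>_in unfolding A_def b_def by auto
  \<comment> \<open>\<open>c\<close> is \<open>a + b\<close> reflected into \<open>I\<close>.
    Without reflection \<open>c\<close> and \<open>b - a\<close> have equal parity; with it the
    parities differ, and the resulting minus sign matches \<open>p - (a + b)\<close> being congruent
    to \<open>- (a + b)\<close>.\<close>
  define c where "c = (if a + b \<le> int n then a + b else int p - (a + b))"
  have c: "c \<in> I" "b - a \<in> I"
    using ab p_eq unfolding c_def by auto
  have odd_p: "odd (int p)"
    using p_eq by simp
  have c_sq: "[c\<^sup>2 = (a + b)\<^sup>2] (mod int p)"
    unfolding square_cong_iff c_def by (auto simp: cong_iff_dvd_diff)
  have prod: "[b\<^sup>2 - a\<^sup>2 = h (b - a) * h c] (mod int p)"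
  proof (cases "a + b \<le> int n")
    case True
    then have "h (b - a) * h c = b\<^sup>2 - a\<^sup>2"
      unfolding h_def c_def by (auto simp: power2_eq_square algebra_simps)
    then show ?thesis
      by simp
  next
    case False
    then have "h (b - a) * h c = - ((b - a) * (int p - (a + b)))"
      unfolding h_def c_def using odd_p by (auto simp: algebra_simps)
    also have "\<dots> = (b\<^sup>2 - a\<^sup>2) - int p * (b - a)"
      by (simp add: power2_eq_square algebra_simps)
    finally show ?thesis
      by (simp add: cong_iff_dvd_diff)
  qed
  have vv: "int p dvd v * v + 1"
    using v by (simp add: cong_iff_dvd_diff power2_eq_square)
  have "[b\<^sup>2 = (v * a)\<^sup>2] (mod int p)"
    unfolding b_def \<sigma>_def by (rule tilde_square)
  \<comment> \<open>The sign decides which of \<open>a\<close> and \<open>b\<close> is sent to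
    \<open>c\<close> and which to \<open>b - a\<close>.\<close>
  then consider "[b = v * a] (mod int p)" | "[b = - (v * a)] (mod int p)"
    unfolding square_cong_iff by blast
  then show ?thesis
  proof cases
    case 1
    then have b: "int p dvd b - v * a"
      by (simp add: cong_iff_dvd_diff)
    have "[a + b = (1 + v) * a] (mod int p)"
      using b by (simp add: cong_iff_dvd_diff algebra_simps)
    then have "\<psi> a = c"
      unfolding \<psi>_def by (intro tilde_eqI c cong_trans[OF c_sq] cong_pow)
    moreover have "[b - a = (1 + v) * b] (mod int p)"
    proof -
      have "b - a - (1 + v) * b = - (v * (b - v * a) + (v * v + 1) * a)"
        by (simp add: algebra_simps)
      moreover have "int p dvd - (v * (b - v * a) + (v * v + 1) * a)"
        using b vv by simp
      ultimately show ?thesis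
        by (simp only: cong_iff_dvd_diff)
    qed
    then have "\<psi> b = b - a"
      unfolding \<psi>_def by (intro tilde_eqI c cong_pow)
    ultimately show ?thesis
      using prod unfolding b_def by (simp only: mult.commute)
  next
    case 2
    then have b: "int p dvd b + v * a"
      by (simp add: cong_iff_dvd_diff)
    have "[b - a = - ((1 + v) * a)] (mod int p)"
      using b by (simp add: cong_iff_dvd_diff algebra_simps)
    then have "[(b - a)\<^sup>2 = (- ((1 + v) * a))\<^sup>2] (mod int p)"
      by (rule cong_pow)
    then have "\<psi> a = b - a"
      unfolding \<psi>_def power2_minus by (intro tilde_eqI c)
    moreover have "[a + b = (1 + v) * b] (mod int p)"
    proof -
      have "a + b - (1 + v) * b = (v * v + 1) * a - v * (b + v * a)"
        by (simp add: algebra_simps)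
      moreover have "int p dvd (v * v + 1) * a - v * (b + v * a)"
        using b vv by simp
      ultimately show ?thesis
        by (simp only: cong_iff_dvd_diff)
    qed
    then have "\<psi> b = c"
      unfolding \<psi>_def by (intro tilde_eqI c cong_trans[OF c_sq] cong_pow)
    ultimately show ?thesis
      using prod unfolding b_def by simp
  qed
qed

lemma prod_square_diff_pairs: "[(\<Prod>a\<in>A. (\<sigma> a)\<^sup>2 - a\<^sup>2) = (- 1) ^ k * fact n] (mod int p)"
proof -
  let ?h = "\<lambda>i :: int. (if even i then 1 else - 1) * i"
  let ?\<psi> = "\<lambda>i. tilde p ((1 + v) * i)"
  have "\<not> int p dvd 1 + v"
  proof
    assume "int p dvd 1 + v"
    \<comment> \<open>\<open>(1 + v) (1 - v) = 1 - v^2\<close> is congruent to 2, hence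
      \<open>1 + v\<close> is a unit.\<close>
    then have "int p dvd (1 + v) * (1 - v)"
      by simp
    moreover have "int p dvd v\<^sup>2 + 1"
      using v by (simp add: cong_iff_dvd_diff)
    ultimately have "int p dvd (1 + v) * (1 - v) + (v\<^sup>2 + 1)"
      by (rule dvd_add)
    then show False
      using not_dvd_2 by (simp add: power2_eq_square algebra_simps)
  qed
  note bij = tilde_mult_bij[OF this]
  have "[(\<Prod>a\<in>A. (\<sigma> a)\<^sup>2 - a\<^sup>2) = (\<Prod>a\<in>A. ?h (?\<psi> a) * ?h (?\<psi> (\<sigma> a)))] (mod int p)"
    by (rule cong_prod) (rule square_diff_pair_cong)
  also have "(\<Prod>a\<in>A. ?h (?\<psi> a) * ?h (?\<psi> (\<sigma> a))) = (\<Prod>i\<in>I. ?h (?\<psi> i))"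
    by (rule prod_over_pairs[symmetric])
  also have "\<dots> = (\<Prod>i\<in>I. ?h i)"
    by (rule prod.reindex_bij_betw[OF bij])
  also have "\<dots> = (\<Prod>i\<in>I. if even i then 1 else - 1) * (\<Prod>i\<in>I. i)"
    by (rule prod.distrib)
  also have "\<dots> = (- 1) ^ k * fact n"
    unfolding prod_int_interval_fact n_eq prod_parity_sign ..
  finally show ?thesis .
qed

text \<open>In \<open>prod_square_diff_omit_cong\<close> the partner \<open>\<sigma> a\<close>
  contributes another factor \<open>2 a^2\<close>, and every other fibre contributes
  \<open>a^4 - b^4\<close>, since \<open>(\<sigma> b)^2\<close> is congruent to
  \<open>- b^2\<close>.\<close>

lemma fourth_power_diff_prod_cong:
  assumes a: "a \<in> A"
  shows "[(2 * a\<^sup>2)\<^sup>2 * (\<Prod>b\<in>A - {a}. (a\<^sup>2 - b\<^sup>2) * (a\<^sup>2 + b\<^sup>2)) = - 1] (mod int p)"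
proof -
  let ?B = "A - {a}"
  have aI: "a \<in> I" and inj: "inj_on \<sigma> ?B" and disj: "?B \<inter> \<sigma> ` ?B = {}"
    using a A_subset inj_\<sigma> A_disjoint by (auto simp: inj_on_def)
  have "\<sigma> ` ?B = \<sigma> ` A - {\<sigma> a}"
    using inj_\<sigma> a by (auto simp: inj_on_def)
  then have eq: "I - {a} = insert (\<sigma> a) (?B \<union> \<sigma> ` ?B)" and notin: "\<sigma> a \<notin> ?B \<union> \<sigma> ` ?B"
    using a A_disjoint \<sigma>_neq[OF aI] unfolding I_eq[symmetric] by auto
  have "(\<Prod>j\<in>I - {a}. a\<^sup>2 - j\<^sup>2) = (a\<^sup>2 - (\<sigma> a)\<^sup>2) * (\<Prod>j\<in>?B \<union> \<sigma> ` ?B. a\<^sup>2 - j\<^sup>2)"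
    unfolding eq by (rule prod.insert) (use finite_A notin in auto)
  also have "(\<Prod>j\<in>?B \<union> \<sigma> ` ?B. a\<^sup>2 - j\<^sup>2) = (\<Prod>b\<in>?B. (a\<^sup>2 - b\<^sup>2) * (a\<^sup>2 - (\<sigma> b)\<^sup>2))"
    by (rule prod_Un_involution) (use finite_A inj disj in auto)
  also have "[(a\<^sup>2 - (\<sigma> a)\<^sup>2) * \<dots>
      = (a\<^sup>2 - - (a\<^sup>2)) * (\<Prod>b\<in>?B. (a\<^sup>2 - b\<^sup>2) * (a\<^sup>2 - - (b\<^sup>2)))] (mod int p)"
    by (intro cong_mult cong_prod cong_diff cong_refl \<sigma>_square)
  also have "a\<^sup>2 - - (a\<^sup>2) = 2 * a\<^sup>2"
    by simp
  finally have "[2 * a\<^sup>2 * (\<Prod>j\<in>I - {a}. a\<^sup>2 - j\<^sup>2)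
      = 2 * a\<^sup>2 * (2 * a\<^sup>2 * (\<Prod>b\<in>?B. (a\<^sup>2 - b\<^sup>2) * (a\<^sup>2 - - (b\<^sup>2))))] (mod int p)"
    by (rule cong_scalar_left)
  then have "[(2 * a\<^sup>2)\<^sup>2 * (\<Prod>b\<in>?B. (a\<^sup>2 - b\<^sup>2) * (a\<^sup>2 - - (b\<^sup>2)))
      = 2 * a\<^sup>2 * (\<Prod>j\<in>I - {a}. a\<^sup>2 - j\<^sup>2)] (mod int p)"
    unfolding power2_eq_square[of "2 * a\<^sup>2"] mult.assoc by (rule cong_sym)
  from cong_trans[OF this prod_square_diff_omit_cong[OF aI]] show ?thesis
    by simp
qed

text \<open>Multiplying \<open>fourth_power_diff_prod_cong\<close> over \<open>A\<close> yields the
  discriminant of the fourth powers; the square of the first product stands for the factors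
  \<open>(2 a^2)^2\<close>.\<close>

lemma fourth_power_discriminant_cong:
  "[(\<Prod>a\<in>A. (\<sigma> a)\<^sup>2 - a\<^sup>2)\<^sup>2
      * ((- 1) ^ (k choose 2) * pairprod (\<lambda>a b. ((a\<^sup>2 - b\<^sup>2) * (a\<^sup>2 + b\<^sup>2))\<^sup>2) A) = (- 1) ^ k] (mod int p)"
proof -
  let ?u = "\<lambda>a b :: int. (a\<^sup>2 - b\<^sup>2) * (a\<^sup>2 + b\<^sup>2)"
  let ?Z = "(- 1) ^ (k choose 2) * pairprod (\<lambda>a b. (?u a b)\<^sup>2) A"
  have "(\<Prod>a\<in>A. \<Prod>b\<in>A - {a}. ?u a b) = pairprod (\<lambda>a b. ?u a b * ?u b a) A"
    by (rule prod_off_diagonal[OF finite_A])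
  \<comment> \<open>\<open>?u\<close> is antisymmetric, which costs one sign for each of the
    \<open>k choose 2\<close> pairs.\<close>
  also have "\<dots> = pairprod (\<lambda>a b. - 1 * (?u a b)\<^sup>2) A"
    by (rule pairprod_cong) (simp add: power2_eq_square algebra_simps)
  also have "\<dots> = ?Z"
    unfolding pairprod_mult pairprod_const[OF finite_A] card_A ..
  finally have Z: "(\<Prod>a\<in>A. \<Prod>b\<in>A - {a}. ?u a b) = ?Z" .
  have "(\<Prod>a\<in>A. (\<sigma> a)\<^sup>2 - a\<^sup>2)\<^sup>2 = (\<Prod>a\<in>A. ((\<sigma> a)\<^sup>2 - a\<^sup>2)\<^sup>2)"
    by (rule prod_power_distrib)
  also have "[\<dots> = (\<Prod>a\<in>A. (- (a\<^sup>2) - a\<^sup>2)\<^sup>2)] (mod int p)"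
    by (intro cong_prod cong_pow cong_diff cong_refl \<sigma>_square)
  also have "(\<Prod>a\<in>A. (- (a\<^sup>2) - a\<^sup>2)\<^sup>2) = (\<Prod>a\<in>A. (2 * a\<^sup>2)\<^sup>2)"
    by (rule prod.cong) (simp_all add: power2_eq_square algebra_simps)
  finally have "[(\<Prod>a\<in>A. (\<sigma> a)\<^sup>2 - a\<^sup>2)\<^sup>2 * ?Z
      = (\<Prod>a\<in>A. (2 * a\<^sup>2)\<^sup>2) * (\<Prod>a\<in>A. \<Prod>b\<in>A - {a}. ?u a b)] (mod int p)"
    unfolding Z by (rule cong_scalar_right)
  also have "(\<Prod>a\<in>A. (2 * a\<^sup>2)\<^sup>2) * (\<Prod>a\<in>A. \<Prod>b\<in>A - {a}. ?u a b)
      = (\<Prod>a\<in>A. (2 * a\<^sup>2)\<^sup>2 * (\<Prod>b\<in>A - {a}. ?u a b))"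
    by (rule prod.distrib[symmetric])
  also have "[\<dots> = (\<Prod>a\<in>A. - 1)] (mod int p)"
    by (rule cong_prod) (rule fourth_power_diff_prod_cong)
  also have "(\<Prod>a\<in>A. - 1) = (- 1 :: int) ^ k"
    by (simp add: card_A)
  finally show ?thesis .
qed

section \<open>Evaluation of the sign for even \<open>n\<close>\<close>

lemma tilde_mult_square_\<sigma>:
  assumes "i \<in> I" "\<not> int p dvd m"
  shows "tilde p (m * (\<sigma> i)\<^sup>2) = tilde p (m * i\<^sup>2)"
proof (rule tilde_eqI)
  show "tilde p (m * i\<^sup>2) \<in> I"
    using not_dvd_interval[OF assms(1)] assms(2)
    by (intro tilde_in_interval) (simp add: prime_dvd_mult_iff[OF prime_int] power2_eq_square)
  \<comment> \<open>Replacing \<open>i\<close> by \<open>\<sigma> i\<close> only negates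
    \<open>m i^2\<close> modulo \<open>p\<close>, and squaring removes the sign.\<close>
  have "[(m * (\<sigma> i)\<^sup>2)\<^sup>2 = (m * - (i\<^sup>2))\<^sup>2] (mod int p)"
    by (intro cong_pow cong_mult cong_refl \<sigma>_square)
  then have "[(m * i\<^sup>2)\<^sup>2 = (m * (\<sigma> i)\<^sup>2)\<^sup>2] (mod int p)"
    by (simp add: cong_sym_eq)
  then show "[(tilde p (m * i\<^sup>2))\<^sup>2 = (m * (\<sigma> i)\<^sup>2)\<^sup>2] (mod int p)"
    by (rule cong_trans[OF tilde_square])
qed

lemma tilde_mult_square_inj:
  assumes "a \<in> A" "b \<in> A" "a \<noteq> b" "\<not> int p dvd m"
  shows "(tilde p (m * a\<^sup>2))\<^sup>2 \<noteq> (tilde p (m * b\<^sup>2))\<^sup>2"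
proof
  have ab: "a \<in> I" "b \<in> I"
    using assms(1,2) A_subset by auto
  assume "(tilde p (m * a\<^sup>2))\<^sup>2 = (tilde p (m * b\<^sup>2))\<^sup>2"
  then have "[(m * b\<^sup>2)\<^sup>2 = (m * a\<^sup>2)\<^sup>2] (mod int p)"
    using tilde_square[of "m * a\<^sup>2"] tilde_square[of "m * b\<^sup>2"] by (metis cong_sym cong_trans)
  then have "[m * b\<^sup>2 = m * a\<^sup>2] (mod int p) \<or> [m * b\<^sup>2 = m * - (a\<^sup>2)] (mod int p)"
    unfolding square_cong_iff[of "m * b\<^sup>2"] by simp
  then have "[b\<^sup>2 = a\<^sup>2] (mod int p) \<or> [b\<^sup>2 = - (a\<^sup>2)] (mod int p)"
    using cong_mult_cancel[OF assms(4)] by blast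
  then have "b = a \<or> b = \<sigma> a"
    using square_cong_interval[OF ab(2,1)] \<sigma>_eqI[OF ab] by blast
  then show False
    using assms(1-3) A_disjoint by auto
qed

lemma pairprod_inversion_sign_even:
  assumes m: "\<not> int p dvd m"
  shows "pairprod (inversion_sign m) I = (- 1) ^ (k choose 2)"
proof -
  let ?f = "\<lambda>i. tilde p (m * i\<^sup>2)"
  let ?s = "inversion_sign m"
  let ?s4 = "\<lambda>a b. ?s a b * ?s a (\<sigma> b) * ?s (\<sigma> a) b * ?s (\<sigma> a) (\<sigma> b)"
  let ?d = "\<lambda>i j :: int. \<bar>i\<^sup>2 - j\<^sup>2\<bar>"
  let ?d4 = "\<lambda>a b. ?d a b * ?d a (\<sigma> b) * ?d (\<sigma> a) b * ?d (\<sigma> a) (\<sigma> b)"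
  let ?e4 = "\<lambda>a b. (a\<^sup>2 - b\<^sup>2) * (a\<^sup>2 - (\<sigma> b)\<^sup>2) * ((\<sigma> a)\<^sup>2 - b\<^sup>2) * ((\<sigma> a)\<^sup>2 - (\<sigma> b)\<^sup>2)"
  define \<epsilon> where "\<epsilon> = pairprod ?s I"
  define D where "D = pairprod ?d I"
  define X where "X = pairprod ?d4 A"
  define E where "E = (\<Prod>a\<in>A. (\<sigma> a)\<^sup>2 - a\<^sup>2)"
  define Z where "Z = pairprod (\<lambda>a b. ((a\<^sup>2 - b\<^sup>2) * (a\<^sup>2 + b\<^sup>2))\<^sup>2) A"
  define c :: int where "c = (- 1) ^ (k choose 2)"
  have AI: "a \<in> I" "\<sigma> a \<in> I" "a < \<sigma> a" if "a \<in> A" for a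
    using that \<sigma>_in unfolding A_def by auto
  have "\<epsilon> = pairprod ?s4 A * (\<Prod>a\<in>A. ?s a (\<sigma> a))"
    unfolding \<epsilon>_def I_eq[symmetric]
    by (rule pairprod_Un_involution[OF finite_A inj_\<sigma> A_disjoint inversion_sign_sym])
  \<comment> \<open>Both indices of a fibre have the same \<open>?f\<close>, so they form no
    inversion.\<close>
  moreover have "(\<Prod>a\<in>A. ?s a (\<sigma> a)) = 1"
    by (rule prod.neutral) (use tilde_mult_square_\<sigma>[OF AI(1) m] in \<open>simp add: inversion_sign_def\<close>)
  ultimately have eps: "\<epsilon> = pairprod ?s4 A"
    by simp
  have "D = X * (\<Prod>a\<in>A. ?d a (\<sigma> a))"
    unfolding D_def X_def I_eq[symmetric]
    by (rule pairprod_Un_involution[OF finite_A inj_\<sigma> A_disjoint]) (rule abs_minus_commute)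
  moreover have "(\<Prod>a\<in>A. ?d a (\<sigma> a)) = E"
    unfolding E_def
  proof (rule prod.cong)
    fix a assume a: "a \<in> A"
    then have "a\<^sup>2 \<le> (\<sigma> a)\<^sup>2"
      using AI[OF a] by (intro power_mono) auto
    then show "?d a (\<sigma> a) = (\<sigma> a)\<^sup>2 - a\<^sup>2"
      by linarith
  qed simp
  ultimately have D: "D = X * E"
    by simp
  have "?s4 a b * ?d4 a b = ?e4 a b" if ab: "a \<in> A" "b \<in> A" "a < b" for a b
  proof -
    \<comment> \<open>\<open>F\<close> is common to the four pairs because \<open>?f\<close> is
      constant on fibres. It enters as a fourth power, where its sign is lost, and then
      cancels.\<close>
    define F where "F = (?f a)\<^sup>2 - (?f b)\<^sup>2"
    have F: "F \<noteq> 0"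
      using tilde_mult_square_inj[OF ab(1,2) _ m] ab(3) unfolding F_def by auto
    have eq: "?s i j * (?d i j * \<bar>F\<bar>) = (i\<^sup>2 - j\<^sup>2) * F" if "i \<in> {a, \<sigma> a}" "j \<in> {b, \<sigma> b}" for i j
    proof -
      have "?f i = ?f a" "?f j = ?f b" "i \<in> I" "j \<in> I"
        using that tilde_mult_square_\<sigma>[OF AI(1) m] ab AI by auto
      then show ?thesis
        using inversion_sign_square_diff[of i j m] m unfolding F_def by simp
    qed
    have "?s4 a b * ?d4 a b * \<bar>F\<bar> ^ 4
        = (?s a b * (?d a b * \<bar>F\<bar>)) * (?s a (\<sigma> b) * (?d a (\<sigma> b) * \<bar>F\<bar>))
          * (?s (\<sigma> a) b * (?d (\<sigma> a) b * \<bar>F\<bar>)) * (?s (\<sigma> a) (\<sigma> b) * (?d (\<sigma> a) (\<sigma> b) * \<bar>F\<bar>))"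
      unfolding power4_eq_xxxx by (simp only: mult.assoc mult.left_commute mult.commute)
    also have "\<dots> = ((a\<^sup>2 - b\<^sup>2) * F) * ((a\<^sup>2 - (\<sigma> b)\<^sup>2) * F)
        * (((\<sigma> a)\<^sup>2 - b\<^sup>2) * F) * (((\<sigma> a)\<^sup>2 - (\<sigma> b)\<^sup>2) * F)"
      using eq[of a b] eq[of a "\<sigma> b"] eq[of "\<sigma> a" b] eq[of "\<sigma> a" "\<sigma> b"] by simp
    also have "\<dots> = ?e4 a b * F ^ 4"
      unfolding power4_eq_xxxx by (simp only: mult.assoc mult.left_commute mult.commute)
    also have "F ^ 4 = \<bar>F\<bar> ^ 4"
      by simp
    finally show ?thesis
      using F by simp
  qed
  then have "pairprod (\<lambda>a b. ?s4 a b * ?d4 a b) A = pairprod ?e4 A"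
    by (rule pairprod_cong)
  then have "\<epsilon> * X = pairprod ?e4 A"
    unfolding eps X_def pairprod_mult[of ?s4 ?d4] .
  moreover have "[pairprod ?e4 A = Z] (mod int p)"
    unfolding Z_def
  proof (rule pairprod_cong_mod)
    fix a b
    have "[?e4 a b = (a\<^sup>2 - b\<^sup>2) * (a\<^sup>2 - - (b\<^sup>2)) * (- (a\<^sup>2) - b\<^sup>2) * (- (a\<^sup>2) - - (b\<^sup>2))] (mod int p)"
      by (intro cong_mult cong_diff cong_refl \<sigma>_square)
    moreover have "(x - y) * (x - - y) * (- x - y) * (- x - - y) = ((x - y) * (x + y))\<^sup>2" for x y :: int
      by (simp add: power2_eq_square algebra_simps)
    ultimately show "[?e4 a b = ((a\<^sup>2 - b\<^sup>2) * (a\<^sup>2 + b\<^sup>2))\<^sup>2] (mod int p)"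
      by (simp only:)
  qed
  ultimately have XZ: "[\<epsilon> * X = Z] (mod int p)"
    by simp
  have E: "[E = (- 1) ^ k * fact n] (mod int p)"
    unfolding E_def by (rule prod_square_diff_pairs)
  have DE: "[D * E = (- 1) ^ k] (mod int p)"
  proof -
    have "[D * E = D * ((- 1) ^ k * fact n)] (mod int p)"
      using E by (rule cong_scalar_left)
    also have "D * ((- 1) ^ k * fact n) = (- 1) ^ k * (D * fact n)"
      by (simp only: mult.left_commute)
    also have "[(- 1) ^ k * (D * fact n) = (- 1) ^ k * 1] (mod int p)"
      unfolding D_def by (rule cong_scalar_left[OF pairprod_square_diff_cong]) (simp add: n_eq)
    finally show ?thesis
      by simp
  qed
  \<comment> \<open>By \<open>D = X * E\<close>, the product \<open>\<epsilon> D E\<close> is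
    \<open>(\<epsilon> X) E^2\<close>. Modulo \<open>p\<close> the former is
    \<open>\<epsilon> (-1)^k\<close> and the latter \<open>c (-1)^k\<close>, whence
    \<open>\<epsilon> = c\<close>.\<close>
  have "[\<epsilon> * (- 1) ^ k = \<epsilon> * (D * E)] (mod int p)"
    by (rule cong_scalar_left[OF cong_sym[OF DE]])
  also have "\<epsilon> * (D * E) = \<epsilon> * X * E\<^sup>2"
    by (simp add: D power2_eq_square)
  also have "[\<epsilon> * X * E\<^sup>2 = Z * E\<^sup>2] (mod int p)"
    using XZ by (rule cong_scalar_right)
  finally have "[c * (\<epsilon> * (- 1) ^ k) = c * (Z * E\<^sup>2)] (mod int p)"
    by (rule cong_scalar_left)
  also have "c * (Z * E\<^sup>2) = E\<^sup>2 * (c * Z)"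
    by simp
  also have "[E\<^sup>2 * (c * Z) = (- 1) ^ k] (mod int p)"
    unfolding E_def c_def Z_def by (rule fourth_power_discriminant_cong)
  finally have "[c * (\<epsilon> * (- 1) ^ k) = (- 1) ^ k] (mod int p)" .
  moreover have sign: "\<bar>\<epsilon>\<bar> = 1" "\<bar>c\<bar> = 1"
    by (simp_all add: \<epsilon>_def c_def s'_eq_pairprod[symmetric] power_abs)
  ultimately have "c * (\<epsilon> * (- 1) ^ k) = (- 1) ^ k"
    using cong_sign_eq by (simp add: abs_mult power_abs)
  then have "c * \<epsilon> = 1"
    by simp
  then have "\<epsilon> = c"
    using sign by (auto simp: abs_if split: if_splits)
  then show ?thesis
    unfolding \<epsilon>_def c_def .
qed

end

section \<open>Combination of the two cases\<close>

lemma (in odd_prime) pairprod_inversion_sign: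
  assumes "\<not> int p dvd m"
  shows "pairprod (inversion_sign m) I = (- 1) ^ ((p + 1) div 8)"
proof (cases "even n")
  case True
  then obtain k where k: "n = 2 * k"
    by (elim evenE)
  \<comment> \<open>This is the middle case of \<open>wilson_split\<close>; for even
    \<open>n\<close> it makes \<open>n!\<close> a square root of -1.\<close>
  have "[fact n * fact (p - 1 - n) = (- 1) ^ (n + 1)] (mod int p)"
    by (rule wilson_split) (simp add: p_eq)
  moreover have "p - 1 - n = n"
    using p_eq by simp
  ultimately have "[(fact n)\<^sup>2 = - 1] (mod int p)"
    using True by (simp add: power2_eq_square)
  then interpret one_mod_four_prime p n k "fact n"
    by unfold_locales (use k in auto)
  have "(p + 1) div 8 = k div 2"
    using p_eq k by simp
  \<comment> \<open>With \<open>t = k div 2\<close>, the binomial coefficient is \<open>t\<close>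
    times an odd number.\<close>
  moreover have "even (k choose 2) \<longleftrightarrow> even (k div 2)"
  proof (cases "even k")
    case True
    then obtain t where t: "k = 2 * t"
      by (elim evenE)
    then have "k choose 2 = t * (2 * t - 1)"
      unfolding choose_two t by simp
    then show ?thesis
      using t by (cases t) (auto simp: binomial_eq_0)
  next
    case False
    then obtain t where t: "k = 2 * t + 1"
      by (elim oddE)
    then have "k choose 2 = (2 * t + 1) * t"
      unfolding choose_two t by simp
    then show ?thesis
      using t by simp
  qed
  ultimately show ?thesis
    using pairprod_inversion_sign_even[OF assms] by (simp add: minus_one_power_iff)
next
  case False
  then show ?thesis
    using pairprod_inversion_sign_odd assms by simp
qed

theorem theorem2p11:
  fixes p :: nat and m :: int
  assumes "prime p" and "odd p" and "\<not> int p dvd m"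
  shows "[int (s' p m) = \<lfloor>(real p + 1) / 8\<rfloor>] (mod 2)"
proof -
  obtain n where "p = 2 * n + 1"
    using assms(2) by (elim oddE)
  then interpret odd_prime p n
    by unfold_locales (use assms(1) in auto)
  have "(- 1 :: int) ^ s' p m = (- 1) ^ ((p + 1) div 8)"
    using s'_eq_pairprod pairprod_inversion_sign[OF assms(3)] by simp
  then have "even (s' p m) \<longleftrightarrow> even ((p + 1) div 8)"
    by (simp add: minus_one_power_iff split: if_splits)
  moreover have "\<lfloor>(real p + 1) / 8\<rfloor> = int ((p + 1) div 8)"
    using floor_divide_of_nat_eq[of "p + 1" 8, where 'a = real] by (simp add: add.commute)
  ultimately show ?thesis
    by (auto simp: cong_def mod_2_eq_odd)
qed

end
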